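(* Let $p$ be an odd prime and let $E,E'$ be ordinary elliptic curves over $\mathbf{F}_p$ related by an isogeny $E\to E'$ of degree 2 defined over $\mathbf{F}_p$. If $|E(\mathbf{F}_p)|\equiv 2\pmod 4$, then $E(\mathbf{F}_{p^2})\cong E'(\mathbf{F}_{p^2})$ as groups. *)

theory Defs
  imports
    "HOL-Algebra.Algebra"
    "HOL-Computational_Algebra.Computational_Algebra"
    "HOL-Number_Theory.Cong"
begin

text \<open>
  As in Weil's language, all curves live over one algebraically closed field \<open>'k\<close>, and
  \<open>defined over L\<close> refers to a subfield \<open>L\<close> of \<open>'k\<close>.
\<close>

section \<open>Finite fields\<close>

text \<open>
  If \<open>q\<close> is a power of the positive characteristic of \<open>'k\<close>, this is the unique
  subfield of \<open>'k\<close> with \<open>q\<close> elements.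
\<close>

definition GF :: "nat \<Rightarrow> 'k::alg_closed_field set" where
  "GF q = {x. x ^ q = x}"


section \<open>Weierstrass curves and their points\<close>

text \<open>\<open>y^2 + a\<^sub>1 x y + a\<^sub>3 y = x^3 + a\<^sub>2 x^2 + a\<^sub>4 x + a\<^sub>6\<close>\<close>

record 'k weierstrass =
  a\<^sub>1 :: 'k
  a\<^sub>2 :: 'k
  a\<^sub>3 :: 'k
  a\<^sub>4 :: 'k
  a\<^sub>6 :: 'k

definition discriminant :: "'k::field weierstrass \<Rightarrow> 'k" where
  "discriminant E =
     (let b2 = (a\<^sub>1 E)\<^sup>2 + 4 * a\<^sub>2 E;
          b4 = 2 * a\<^sub>4 E + a\<^sub>1 E * a\<^sub>3 E;
          b6 = (a\<^sub>3 E)\<^sup>2 + 4 * a\<^sub>6 E;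
          b8 = (a\<^sub>1 E)\<^sup>2 * a\<^sub>6 E + 4 * a\<^sub>2 E * a\<^sub>6 E - a\<^sub>1 E * a\<^sub>3 E * a\<^sub>4 E
                 + a\<^sub>2 E * (a\<^sub>3 E)\<^sup>2 - (a\<^sub>4 E)\<^sup>2
      in - (b2\<^sup>2 * b8) - 8 * b4 ^ 3 - 27 * b6\<^sup>2 + 9 * b2 * b4 * b6)"

definition elliptic_curve_over :: "'k::field set \<Rightarrow> 'k weierstrass \<Rightarrow> bool" where
  "elliptic_curve_over L E \<longleftrightarrow>
     {a\<^sub>1 E, a\<^sub>2 E, a\<^sub>3 E, a\<^sub>4 E, a\<^sub>6 E} \<subseteq> L \<and> discriminant E \<noteq> 0"

datatype 'k point = Infinity | Affine 'k 'k

fun on_curve :: "'k::field weierstrass \<Rightarrow> 'k point \<Rightarrow> bool" where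
  "on_curve E Infinity \<longleftrightarrow> True"
| "on_curve E (Affine x y) \<longleftrightarrow>
     y\<^sup>2 + a\<^sub>1 E * x * y + a\<^sub>3 E * y = x ^ 3 + a\<^sub>2 E * x\<^sup>2 + a\<^sub>4 E * x + a\<^sub>6 E"

fun rational_point :: "'k set \<Rightarrow> 'k point \<Rightarrow> bool" where
  "rational_point L Infinity \<longleftrightarrow> True"
| "rational_point L (Affine x y) \<longleftrightarrow> x \<in> L \<and> y \<in> L"

definition points :: "'k::field set \<Rightarrow> 'k weierstrass \<Rightarrow> 'k point set" where
  "points L E = {P. on_curve E P \<and> rational_point L P}"


section \<open>The chord-and-tangent group law\<close>

fun point_add :: "'k::field weierstrass \<Rightarrow> 'k point \<Rightarrow> 'k point \<Rightarrow> 'k point" where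
  "point_add E Infinity Q = Q"
| "point_add E (Affine x y) Infinity = Affine x y"
| "point_add E (Affine x1 y1) (Affine x2 y2) =
     (if x1 = x2 \<and> y1 + y2 + a\<^sub>1 E * x2 + a\<^sub>3 E = 0 then Infinity
      else
        let l = (if x1 = x2
                 then (3 * x1\<^sup>2 + 2 * a\<^sub>2 E * x1 + a\<^sub>4 E - a\<^sub>1 E * y1) / (2 * y1 + a\<^sub>1 E * x1 + a\<^sub>3 E)
                 else (y2 - y1) / (x2 - x1));
            x3 = l\<^sup>2 + a\<^sub>1 E * l - a\<^sub>2 E - x1 - x2
        in Affine x3 (- (l + a\<^sub>1 E) * x3 - (y1 - l * x1) - a\<^sub>3 E))"

definition point_group :: "'k::field set \<Rightarrow> 'k weierstrass \<Rightarrow> 'k point monoid" where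
  "point_group L E = \<lparr>carrier = points L E, monoid.mult = point_add E, one = Infinity\<rparr>"

text \<open>An elliptic curve in characteristic \<open>p > 0\<close> is ordinary iff \<open>E[p] \<noteq> 0\<close>.\<close>

definition ordinary :: "'k::alg_closed_field weierstrass \<Rightarrow> bool" where
  "ordinary E \<longleftrightarrow> (\<exists>P \<in> points UNIV E.
     P \<noteq> Infinity \<and> P [^]\<^bsub>point_group UNIV E\<^esub> CHAR('k) = Infinity)"


section \<open>Morphisms\<close>

fun coords :: "'k::field point \<Rightarrow> 'k \<times> 'k \<times> 'k" where
  "coords Infinity = (0, 1, 0)"
| "coords (Affine x y) = (x, y, 1)"

text \<open>
  The value at \<open>P\<close> of the homogeneous form of degree \<open>d\<close> in which
  \<open>x^i y^j z^(d - i - j)\<close> has coefficient \<open>F i j\<close>. It depends on the choice of \<open>coords P\<close>,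
  unlike quotients of two such forms.
\<close>

definition form_at :: "nat \<Rightarrow> (nat \<Rightarrow> nat \<Rightarrow> 'k::field) \<Rightarrow> 'k point \<Rightarrow> 'k" where
  "form_at d F P =
     (case coords P of (x, y, z) \<Rightarrow> \<Sum>i\<le>d. \<Sum>j\<le>d - i. F i j * x ^ i * y ^ j * z ^ (d - i - j))"

text \<open>
  Around every point of \<open>E\<close>, the map must be given by three forms of the same degree with
  coefficients in \<open>L\<close> and without common zero at that point.
\<close>

definition morphism_over ::
  "'k::alg_closed_field set \<Rightarrow> 'k weierstrass \<Rightarrow> 'k weierstrass \<Rightarrow> ('k point \<Rightarrow> 'k point) \<Rightarrow> bool"
where
  "morphism_over L E E' \<phi> \<longleftrightarrow>
     \<phi> \<in> points UNIV E \<rightarrow> points UNIV E' \<and>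
     (\<forall>P \<in> points UNIV E. \<exists>d F G H.
        (\<forall>i j. F i j \<in> L \<and> G i j \<in> L \<and> H i j \<in> L) \<and>
        (form_at d F P, form_at d G P, form_at d H P) \<noteq> (0, 0, 0) \<and>
        (\<forall>Q \<in> points UNIV E.
           (form_at d F Q, form_at d G Q, form_at d H Q) \<noteq> (0, 0, 0) \<longrightarrow>
           (\<exists>c. c \<noteq> 0 \<and> (case coords (\<phi> Q) of (x, y, z) \<Rightarrow>
              form_at d F Q = c * x \<and> form_at d G Q = c * y \<and> form_at d H Q = c * z))))"

text \<open>
  An isogeny is a surjective homomorphism of algebraic groups with finite kernel; for elliptic
  curves, surjectivity already makes the kernel finite.
\<close>

definition isogeny_over ::
  "'k::alg_closed_field set \<Rightarrow> 'k weierstrass \<Rightarrow> 'k weierstrass \<Rightarrow> ('k point \<Rightarrow> 'k point) \<Rightarrow> bool"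
where
  "isogeny_over L E E' \<phi> \<longleftrightarrow>
     morphism_over L E E' \<phi> \<and>
     \<phi> ` points UNIV E = points UNIV E' \<and>
     \<phi> \<in> hom (point_group UNIV E) (point_group UNIV E')"


section \<open>Function fields and the degree of an isogeny\<close>

text \<open>
  A rational function on \<open>E\<close> is determined by its values at all but finitely many points. The
  function field \<open>L(E)\<close> is therefore realised inside the ring of all functions on points modulo
  those that vanish at all but finitely many points of \<open>E\<close>: it consists of the classes of the
  quotients of two forms of equal degree over \<open>L\<close> whose denominator does not vanish
  identically on \<open>E\<close>.
\<close>

definition fun_ring :: "('k::field point \<Rightarrow> 'k) ring" where
  "fun_ring = \<lparr>carrier = UNIV, monoid.mult = (\<lambda>f g P. f P * g P), one = (\<lambda>_. 1),
               ring.zero = (\<lambda>_. 0), add = (\<lambda>f g P. f P + g P)\<rparr>"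

definition almost_zero :: "'k::alg_closed_field weierstrass \<Rightarrow> ('k point \<Rightarrow> 'k) set" where
  "almost_zero E = {f. finite {P \<in> points UNIV E. f P \<noteq> 0}}"

definition germ_ring :: "'k::alg_closed_field weierstrass \<Rightarrow> ('k point \<Rightarrow> 'k) set ring" where
  "germ_ring E = fun_ring Quot almost_zero E"

definition germ :: "'k::alg_closed_field weierstrass \<Rightarrow> ('k point \<Rightarrow> 'k) \<Rightarrow> ('k point \<Rightarrow> 'k) set" where
  "germ E f = almost_zero E +>\<^bsub>fun_ring\<^esub> f"

definition function_field ::
  "'k::alg_closed_field set \<Rightarrow> 'k weierstrass \<Rightarrow> ('k point \<Rightarrow> 'k) set set"
where
  "function_field L E =
     {germ E (\<lambda>P. form_at d F P / form_at d G P) | d F G.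
        (\<forall>i j. F i j \<in> L \<and> G i j \<in> L) \<and> (\<exists>P \<in> points UNIV E. form_at d G P \<noteq> 0)}"

text \<open>
  The image of \<open>\<phi>\<^sup>* : L(E') \<rightarrow> L(E)\<close>. Composition with \<open>\<phi>\<close> respects the classes because a
  nonconstant morphism has finite fibres.
\<close>

definition pullback_field ::
  "'k::alg_closed_field set \<Rightarrow> 'k weierstrass \<Rightarrow> 'k weierstrass \<Rightarrow> ('k point \<Rightarrow> 'k point)
     \<Rightarrow> ('k point \<Rightarrow> 'k) set set"
where
  "pullback_field L E E' \<phi> = {germ E (f \<circ> \<phi>) | f. germ E' f \<in> function_field L E'}"

text \<open>\<open>[L(E) : \<phi>\<^sup>* L(E')] = n\<close>\<close>

definition has_degree ::
  "'k::alg_closed_field set \<Rightarrow> 'k weierstrass \<Rightarrow> 'k weierstrass \<Rightarrow> ('k point \<Rightarrow> 'k point)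
     \<Rightarrow> nat \<Rightarrow> bool"
where
  "has_degree L E E' \<phi> n \<longleftrightarrow>
     ring.dimension (germ_ring E) n (pullback_field L E E' \<phi>) (function_field L E)"

end

theory Submission
  imports Defs
begin

text \<open>
  The kernel of the isogeny \<open>\<phi>\<close> has at most two points: the functions \<open>1, x, x^2\<close> are linearly
  dependent over the image of \<open>\<phi>\<^sup>*\<close>, so \<open>x\<close> takes at most two values on almost every coset of the
  kernel, which is impossible for three kernel points. If \<open>\<phi>\<close> is injective, it restricts to an
  isomorphism of the groups of points fixed by the square of Frobenius \<open>\<pi>\<close>. Otherwise the kernel is
  \<open>{O, T}\<close>, and \<open>\<phi>\<close> is still bijective on the points of odd order.

  For the 2-parts, both \<open>E(F_p)\<close> and its quadratic twist \<open>{P. \<pi> P = - P}\<close> have order 2 modulo 4,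
  since the two orders add up to \<open>2 (p + 1)\<close>. If \<open>P\<close> in \<open>E(F_{p^2})\<close> has order dividing 4, then
  \<open>P + \<pi> P\<close> lies in the first group and \<open>P - \<pi> P\<close> in the second, hence both are \<open>O\<close> or \<open>T\<close>,
  and this forces \<open>2 P = O\<close>. So the 2-part of \<open>E(F_{p^2})\<close> is the full 2-torsion group, of order
  4, and lifting along \<open>\<phi>\<close> shows the same for \<open>E'\<close>.
\<close>

section \<open>The group law\<close>

text \<open>The degree is a degree of function fields over \<open>GF p\<close>, while the argument
  is about points. Only an upper bound for the kernel is extracted from it; treating an injective
  \<phi> as a case of its own avoids any discussion of separability.

  On the 2-parts \<phi> cannot serve as the isomorphism, because it kills T. The congruence on
  |E(F_p)| makes T the only rational point of order 2, so Frobenius exchanges the other two. Points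
  of order 4 over F_{p^2} are excluded because 2 P is the sum of P + \<pi> P and P - \<pi> P. If one
  of these is O, then P lies in a group whose order is 2 modulo 4, and such a group has no element
  of order 4; if both are T, then 2 P = 2 T = O. On E' a hypothetical point of order 4 is lifted to
  E, where it produces a forbidden point. Once both 2-parts are Klein four groups, any isomorphism
  between them can replace \<phi> there.\<close>

text \<open>
  The equations compare the coefficients on both sides of
  \<open>(l x + n)^2 + a1 x (l x + n) + a3 (l x + n) - (x^3 + a2 x^2 + a4 x + a6) = - (x - x1) (x - x2) (x - x3)\<close>.
\<close>

definition line_meets :: "'k::field weierstrass \<Rightarrow> 'k \<Rightarrow> 'k \<Rightarrow> 'k \<Rightarrow> 'k \<Rightarrow> 'k \<Rightarrow> bool" where
  "line_meets E l n x1 x2 x3 \<longleftrightarrow>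
     l\<^sup>2 + a\<^sub>1 E * l - a\<^sub>2 E = x1 + x2 + x3 \<and>
     2 * l * n + a\<^sub>1 E * n + a\<^sub>3 E * l - a\<^sub>4 E = - (x1 * x2 + x1 * x3 + x2 * x3) \<and>
     n\<^sup>2 + a\<^sub>3 E * n - a\<^sub>6 E = x1 * x2 * x3"

text \<open>The Jacobian criterion at affine points: the two conditions concern the partial
  derivatives of the Weierstrass equation in y and in x.\<close>

definition nonsingular :: "'k::field weierstrass \<Rightarrow> bool" where
  "nonsingular E \<longleftrightarrow> (\<forall>x y. on_curve E (Affine x y) \<longrightarrow> 2 * y + a\<^sub>1 E * x + a\<^sub>3 E = 0 \<longrightarrow>
     a\<^sub>1 E * y \<noteq> 3 * x\<^sup>2 + 2 * a\<^sub>2 E * x + a\<^sub>4 E)"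

fun point_neg :: "'k::field weierstrass \<Rightarrow> 'k point \<Rightarrow> 'k point" where
  "point_neg E Infinity = Infinity"
| "point_neg E (Affine x y) = Affine x (- y - a\<^sub>1 E * x - a\<^sub>3 E)"

text \<open>A singular point (x, y) determines a3, a4 and a6 in terms of x, y, a1 and a2, without
  any division. After substitution the discriminant vanishes identically, so the argument is valid
  in every characteristic.\<close>

lemma discriminant_nonzero_imp_nonsingular:
  assumes "discriminant E \<noteq> 0"
  shows "nonsingular E"
  unfolding nonsingular_def
proof (intro allI impI notI)
  fix x y
  assume c: "on_curve E (Affine x y)" and v: "2 * y + a\<^sub>1 E * x + a\<^sub>3 E = 0"
    and h: "a\<^sub>1 E * y = 3 * x\<^sup>2 + 2 * a\<^sub>2 E * x + a\<^sub>4 E"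
  define a b where "a = a\<^sub>1 E" and "b = a\<^sub>2 E"
  have 3: "a\<^sub>3 E = - 2 * y - a * x" using v unfolding a_def by Groebner_Basis.algebra
  have 4: "a\<^sub>4 E = a * y - 3 * x\<^sup>2 - 2 * b * x" using h unfolding a_def b_def by Groebner_Basis.algebra
  have 6: "a\<^sub>6 E = y\<^sup>2 + a * x * y + (- 2 * y - a * x) * y - x ^ 3 - b * x\<^sup>2 - (a * y - 3 * x\<^sup>2 - 2 * b * x) * x"
    using c unfolding on_curve.simps 3 4 a_def[symmetric] b_def[symmetric] by Groebner_Basis.algebra
  have "discriminant E = 0"
    unfolding discriminant_def Let_def 3 4 6 a_def[symmetric] b_def[symmetric] by Groebner_Basis.algebra
  then show False using assms by simp
qed

section \<open>Lines meeting the curve, and the chord-and-tangent law in terms of them\<close>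

lemma line_meets_swap:
  "line_meets E l n x1 x2 x3 \<Longrightarrow> line_meets E l n x2 x1 x3"
  "line_meets E l n x1 x2 x3 \<Longrightarrow> line_meets E l n x1 x3 x2"
  by (auto simp: line_meets_def algebra_simps)

text \<open>Negation of points sends the line \<open>y = l x + n\<close> to the line with these
  coefficients and preserves abscissae.\<close>

lemma line_meets_conj:
  "line_meets E l n x1 x2 x3 \<Longrightarrow> line_meets E (- l - a\<^sub>1 E) (- n - a\<^sub>3 E) x1 x2 x3"
  unfolding line_meets_def by Groebner_Basis.algebra

lemma line_meets_eval:
  assumes "line_meets E l n x1 x2 x3"
  shows "(l * x + n)\<^sup>2 + a\<^sub>1 E * x * (l * x + n) + a\<^sub>3 E * (l * x + n) -
    (x ^ 3 + a\<^sub>2 E * x\<^sup>2 + a\<^sub>4 E * x + a\<^sub>6 E) = - ((x - x1) * (x - x2) * (x - x3))"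
  using assms unfolding line_meets_def by Groebner_Basis.algebra

lemma line_meets_on_curve:
  assumes "line_meets E l n x1 x2 x3"
  shows "on_curve E (Affine x3 (l * x3 + n))"
  using line_meets_eval[OF assms, of x3] by simp

text \<open>This is the derivative of the identity in \<open>line_meets_eval\<close> at a double
  root, that is, the tangency condition.\<close>

lemma line_meets_double:
  assumes "line_meets E l n x x x3"
  shows "l * (2 * (l * x + n) + a\<^sub>1 E * x + a\<^sub>3 E) = 3 * x\<^sup>2 + 2 * a\<^sub>2 E * x + a\<^sub>4 E - a\<^sub>1 E * (l * x + n)"
  using assms unfolding line_meets_def by Groebner_Basis.algebra

lemma line_meets_exists:
  assumes P: "on_curve E (Affine x1 y1)" and Q: "on_curve E (Affine x2 y2)"
    and ne: "\<not> (x1 = x2 \<and> y1 + y2 + a\<^sub>1 E * x2 + a\<^sub>3 E = 0)"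
  obtains l n x3 where "line_meets E l n x1 x2 x3" "y1 = l * x1 + n" "y2 = l * x2 + n"
proof (cases "x1 = x2")
  case True
  \<comment> \<open>Both ordinates are roots of one quadratic, so they are equal or conjugate;
    \<open>ne\<close> excludes the latter.\<close>
  have "(y1 - y2) * (y1 + y2 + a\<^sub>1 E * x2 + a\<^sub>3 E) = 0"
    using P Q True by simp Groebner_Basis.algebra
  then have y: "y1 = y2" using ne True by auto
  define d where "d = 2 * y1 + a\<^sub>1 E * x1 + a\<^sub>3 E"
  have d: "d \<noteq> 0" using ne True y by (auto simp: d_def algebra_simps)
  define l where "l = (3 * x1\<^sup>2 + 2 * a\<^sub>2 E * x1 + a\<^sub>4 E - a\<^sub>1 E * y1) / d"
  define n x3 where "n = y1 - l * x1" and "x3 = l\<^sup>2 + a\<^sub>1 E * l - a\<^sub>2 E - 2 * x1"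
  have l: "l * (2 * y1 + a\<^sub>1 E * x1 + a\<^sub>3 E) = 3 * x1\<^sup>2 + 2 * a\<^sub>2 E * x1 + a\<^sub>4 E - a\<^sub>1 E * y1"
    using d by (simp add: l_def d_def)
  have "line_meets E l n x1 x2 x3"
    using l P True[symmetric] unfolding line_meets_def n_def x3_def on_curve.simps
    by (intro conjI; simp) Groebner_Basis.algebra+
  moreover have "y1 = l * x1 + n" "y2 = l * x2 + n" using True y by (simp_all add: n_def)
  ultimately show ?thesis by (rule that)
next
  case False
  define l where "l = (y2 - y1) / (x2 - x1)"
  define n x3 where "n = y1 - l * x1" and "x3 = l\<^sup>2 + a\<^sub>1 E * l - a\<^sub>2 E - x1 - x2"
  have l: "l * (x2 - x1) = y2 - y1" using False by (simp add: l_def)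
  have n1: "y1 = l * x1 + n" and n2: "y2 = l * x2 + n" using l by (auto simp: n_def algebra_simps)
  have *: "(x2 - x1) * u = 0 \<Longrightarrow> u = 0" for u using False by simp
  \<comment> \<open>With \<open>x3\<close> chosen to match the quadratic coefficient, the two sides
    of the factorisation differ by a linear polynomial in x with roots \<open>x1\<close> and
    \<open>x2\<close>. Its slope vanishes because these are distinct, and then so does its constant
    term.\<close>
  have e2: "2 * l * n + a\<^sub>1 E * n + a\<^sub>3 E * l - a\<^sub>4 E + (x1 * x2 + x1 * x3 + x2 * x3) = 0"
  proof (rule *)
    show "(x2 - x1) * (2 * l * n + a\<^sub>1 E * n + a\<^sub>3 E * l - a\<^sub>4 E + (x1 * x2 + x1 * x3 + x2 * x3)) = 0"
      using P Q unfolding on_curve.simps x3_def n1 n2 by Groebner_Basis.algebra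
  qed
  have "line_meets E l n x1 x2 x3"
    unfolding line_meets_def
  proof (intro conjI)
    show "l\<^sup>2 + a\<^sub>1 E * l - a\<^sub>2 E = x1 + x2 + x3" by (simp add: x3_def)
    then show "n\<^sup>2 + a\<^sub>3 E * n - a\<^sub>6 E = x1 * x2 * x3"
      using P e2 unfolding on_curve.simps n1 by Groebner_Basis.algebra
    show "2 * l * n + a\<^sub>1 E * n + a\<^sub>3 E * l - a\<^sub>4 E = - (x1 * x2 + x1 * x3 + x2 * x3)"
      using e2 by Groebner_Basis.algebra
  qed
  then show ?thesis using n1 n2 by (rule that)
qed

text \<open>The bridge from the defining formula to geometry: tangent and chord become one case, and
  later arguments need only the three abscissae on a line.\<close>

lemma point_add_line:
  assumes L: "line_meets E l n x1 x2 x3"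
    and ne: "\<not> (x1 = x2 \<and> (l * x1 + n) + (l * x2 + n) + a\<^sub>1 E * x2 + a\<^sub>3 E = 0)"
  shows "point_add E (Affine x1 (l * x1 + n)) (Affine x2 (l * x2 + n)) =
    point_neg E (Affine x3 (l * x3 + n))"
proof -
  have x3: "x3 = l\<^sup>2 + a\<^sub>1 E * l - a\<^sub>2 E - x1 - x2"
    using L unfolding line_meets_def by Groebner_Basis.algebra
  have s: "(if x1 = x2
             then (3 * x1\<^sup>2 + 2 * a\<^sub>2 E * x1 + a\<^sub>4 E - a\<^sub>1 E * (l * x1 + n)) /
               (2 * (l * x1 + n) + a\<^sub>1 E * x1 + a\<^sub>3 E)
             else ((l * x2 + n) - (l * x1 + n)) / (x2 - x1)) = l"
  proof (cases "x1 = x2")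
    case True
    have "l * (2 * (l * x1 + n) + a\<^sub>1 E * x1 + a\<^sub>3 E) =
        3 * x1\<^sup>2 + 2 * a\<^sub>2 E * x1 + a\<^sub>4 E - a\<^sub>1 E * (l * x1 + n)"
      using line_meets_double[of E l n x1 x3] L True by simp
    moreover have "2 * (l * x1 + n) + a\<^sub>1 E * x1 + a\<^sub>3 E \<noteq> 0"
      using ne True by (auto simp: algebra_simps)
    ultimately show ?thesis using True by (simp add: nonzero_divide_eq_eq)
  next
    case False
    have "(l * x2 + n) - (l * x1 + n) = l * (x2 - x1)" by (simp add: algebra_simps)
    with False show ?thesis by simp
  qed
  show ?thesis
    unfolding point_add.simps s Let_def x3[symmetric] using ne
    by (simp add: algebra_simps)
qed

lemma point_neg_neg [simp]: "point_neg E (point_neg E P) = P"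
  by (cases P) auto

lemma on_curve_neg [simp]: "on_curve E (point_neg E P) \<longleftrightarrow> on_curve E P"
proof -
  have *: "on_curve E P \<Longrightarrow> on_curve E (point_neg E P)" for P
    by (cases P) (auto simp: power2_eq_square algebra_simps)
  show ?thesis using *[of P] *[of "point_neg E P"] by auto
qed

lemma point_add_eq_Infinity_iff:
  "point_add E P Q = Infinity \<longleftrightarrow> Q = point_neg E P"
proof (cases P; cases Q)
  fix x1 y1 x2 y2
  assume "P = Affine x1 y1" "Q = Affine x2 y2"
  moreover have "y1 + y2 + a\<^sub>1 E * x1 + a\<^sub>3 E = 0 \<longleftrightarrow> y2 = - y1 - a\<^sub>1 E * x1 - a\<^sub>3 E"
    by Groebner_Basis.algebra
  ultimately show ?thesis by (auto simp: Let_def)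
qed auto

lemma point_add_Infinity_right [simp]: "point_add E P Infinity = P"
  by (cases P) auto

lemma point_add_line_cases:
  assumes "on_curve E (Affine x1 y1)" "on_curve E (Affine x2 y2)"
  obtains (opposite) "Affine x2 y2 = point_neg E (Affine x1 y1)"
  | (line) l n x3 where "line_meets E l n x1 x2 x3" "y1 = l * x1 + n" "y2 = l * x2 + n"
      "point_add E (Affine x1 y1) (Affine x2 y2) = point_neg E (Affine x3 (l * x3 + n))"
      "\<not> (x1 = x2 \<and> y1 + y2 + a\<^sub>1 E * x2 + a\<^sub>3 E = 0)"
proof (cases "x1 = x2 \<and> y1 + y2 + a\<^sub>1 E * x2 + a\<^sub>3 E = 0")
  case True
  then have "point_add E (Affine x1 y1) (Affine x2 y2) = Infinity" by simp
  then show ?thesis using opposite by (simp only: point_add_eq_Infinity_iff)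
next
  case False
  from line_meets_exists[OF assms False] obtain l n x3 where
    "line_meets E l n x1 x2 x3" "y1 = l * x1 + n" "y2 = l * x2 + n" by blast
  then show ?thesis using line point_add_line False by metis
qed

lemma on_curve_add:
  assumes P: "on_curve E P" and Q: "on_curve E Q"
  shows "on_curve E (point_add E P Q)"
proof (cases P; cases Q)
  fix x1 y1 x2 y2
  assume PQ: "P = Affine x1 y1" "Q = Affine x2 y2"
  have c: "on_curve E (Affine x1 y1)" "on_curve E (Affine x2 y2)" using P Q PQ by auto
  from c show ?thesis
  proof (cases rule: point_add_line_cases)
    case opposite
    then have "point_add E P Q = Infinity" unfolding PQ point_add_eq_Infinity_iff .
    then show ?thesis by simp
  next
    case (line l n x3)
    show ?thesis unfolding PQ line(4) on_curve_neg using line_meets_on_curve[OF line(1)] .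
  qed
qed (use P Q in auto)

lemma point_add_commute:
  assumes P: "on_curve E P" and Q: "on_curve E Q"
  shows "point_add E P Q = point_add E Q P"
proof (cases P; cases Q)
  fix x1 y1 x2 y2
  assume PQ: "P = Affine x1 y1" "Q = Affine x2 y2"
  have c: "on_curve E (Affine x1 y1)" "on_curve E (Affine x2 y2)" using P Q PQ by auto
  from c show ?thesis
  proof (cases rule: point_add_line_cases)
    case opposite
    then have "point_add E P Q = Infinity" "point_add E Q P = Infinity"
      unfolding PQ point_add_eq_Infinity_iff by auto
    then show ?thesis by simp
  next
    case (line l n x3)
    have "point_add E (Affine x2 (l * x2 + n)) (Affine x1 (l * x1 + n)) =
        point_neg E (Affine x3 (l * x3 + n))"
      using line(5) unfolding line(2,3)
      by (intro point_add_line[OF line_meets_swap(1)[OF line(1)]]) (auto simp: algebra_simps)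
    then show ?thesis unfolding PQ line(4) by (simp only: line(2,3))
  qed
qed auto

text \<open>The reflected line passes through P + Q and - Q, and its remaining intersection is - P.
  This cancellation law is available before associativity and is what the proof of associativity
  rests on.\<close>

lemma point_add_neg_cancel:
  assumes ns: "nonsingular E" and P: "on_curve E P" and Q: "on_curve E Q"
  shows "point_add E (point_add E P Q) (point_neg E Q) = P"
proof (cases P; cases Q)
  fix x1 y1 x2 y2
  assume PQ: "P = Affine x1 y1" "Q = Affine x2 y2"
  have c: "on_curve E (Affine x1 y1)" "on_curve E (Affine x2 y2)" using P Q PQ by auto
  from c show ?thesis
  proof (cases rule: point_add_line_cases)
    case opposite
    then have "point_add E P Q = Infinity" unfolding PQ point_add_eq_Infinity_iff .
    then show ?thesis using opposite PQ by simp
  next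
    case (line l n x3)
    define l' n' where "l' = - l - a\<^sub>1 E" and "n' = - n - a\<^sub>3 E"
    have neg: "point_neg E (Affine x (l * x + n)) = Affine x (l' * x + n')" for x
      by (simp add: l'_def n'_def algebra_simps)
    have neg': "point_neg E (Affine x (l' * x + n')) = Affine x (l * x + n)" for x
      by (simp add: l'_def n'_def algebra_simps)
    have L': "line_meets E l' n' x3 x2 x1"
      using line_meets_conj[OF line(1)] line_meets_swap unfolding l'_def n'_def by blast
    \<comment> \<open>Otherwise Q would be a point with vertical tangent at which the non-vertical
      line through P and Q has double contact. Then both partial derivatives vanish there, against
      nonsingularity.\<close>
    have "\<not> (x3 = x2 \<and> (l' * x3 + n') + (l' * x2 + n') + a\<^sub>1 E * x2 + a\<^sub>3 E = 0)"
    proof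
      assume a: "x3 = x2 \<and> (l' * x3 + n') + (l' * x2 + n') + a\<^sub>1 E * x2 + a\<^sub>3 E = 0"
      then have "(l' * x2 + n') + (l' * x2 + n') + a\<^sub>1 E * x2 + a\<^sub>3 E = 0" by metis
      then have v: "2 * y2 + a\<^sub>1 E * x2 + a\<^sub>3 E = 0"
        unfolding line(3) l'_def n'_def by Groebner_Basis.algebra
      have "line_meets E l n x2 x2 x1" using line(1) a line_meets_swap by blast
      from line_meets_double[OF this] v
      have "a\<^sub>1 E * y2 = 3 * x2\<^sup>2 + 2 * a\<^sub>2 E * x2 + a\<^sub>4 E"
        unfolding line(3) by simp
      with ns v c(2) show False unfolding nonsingular_def by blast
    qed
    from point_add_line[OF L' this] show ?thesis
      unfolding PQ line(4) unfolding line(2,3) neg neg' .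
  qed
next
  assume "P = Infinity" "Q = Infinity" then show ?thesis by simp
next
  fix x y assume "P = Affine x y" "Q = Infinity" then show ?thesis by simp
next
  fix x y assume "P = Infinity" "Q = Affine x y"
  then show ?thesis by (simp add: point_add_eq_Infinity_iff[of E "Affine x y", simplified])
qed

text \<open>
  This is the source of associativity. Here \<open>l x + n + m (x - x1) (x - x2)\<close> is the parabola through three points of the curve with
  abscissae \<open>x1, x2, x3\<close>, and \<open>x4\<close> is the abscissa of its remaining intersection. The right-hand side does not depend on the
  order in which the three points are added.
\<close>

lemma point_add_parabola:
  fixes l n m x1 x2 x3 x4 x5 :: "'k::field"
  defines "q \<equiv> \<lambda>x. l * x + n + m * (x - x1) * (x - x2)"
  assumes L: "line_meets E l n x1 x2 x5" and m: "m \<noteq> 0"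
    and q1: "- (m\<^sup>2 * (x1 + x2)) + m * (2 * l + a\<^sub>1 E) - 1 = - (m\<^sup>2 * (x3 + x4))"
    and q0: "m\<^sup>2 * x1 * x2 + m * (2 * n + a\<^sub>3 E) + x5 = m\<^sup>2 * x3 * x4"
    and ne: "Affine x3 (q x3) \<noteq> Affine x5 (l * x5 + n)"
  shows "point_add E (point_neg E (Affine x5 (l * x5 + n))) (Affine x3 (q x3)) =
    point_neg E (Affine x4 (q x4))"
proof -
  define k where "k = inverse m"
  have k: "m * k = 1" using m by (simp add: k_def)
  \<comment> \<open>The line through the reflection of the point over \<open>x5\<close> with slope
    chosen so that parabola minus line equals \<open>m (x - x3) (x - x4)\<close>. Thus it meets the
    parabola exactly over \<open>x3\<close> and \<open>x4\<close>.\<close>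
  define l' n' where "l' = - l - a\<^sub>1 E + k" and "n' = - n - a\<^sub>3 E - x5 * k"
  have c: "m * u = 0 \<Longrightarrow> u = 0" for u using m by simp
  have ev: "m * (x - x1) * (x - x2) + 2 * (l * x + n) + a\<^sub>1 E * x + a\<^sub>3 E - k * (x - x5) =
      m * (x - x3) * (x - x4)" for x
  proof -
    \<comment> \<open>Substituting the parabola into the curve equation gives a quartic divisible by
      \<open>(x - x1) (x - x2)\<close>. The assumptions \<open>q1\<close> and \<open>q0\<close> say
      that the cofactor is \<open>m^2 (x - x3) (x - x4)\<close>.\<close>
    have "m * (m * (x - x1) * (x - x2) + 2 * (l * x + n) + a\<^sub>1 E * x + a\<^sub>3 E - k * (x - x5) -
        m * (x - x3) * (x - x4)) = 0"
      using q1 q0 k by Groebner_Basis.algebra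
    from c[OF this] show ?thesis by (simp only: right_minus_eq)
  qed
  have y3: "l' * x3 + n' = q x3" and y4: "l' * x4 + n' = q x4"
    subgoal using ev[of x3] unfolding l'_def n'_def q_def by Groebner_Basis.algebra
    subgoal using ev[of x4] unfolding l'_def n'_def q_def by Groebner_Basis.algebra
    done
  have y5: "point_neg E (Affine x5 (l * x5 + n)) = Affine x5 (l' * x5 + n')"
    by (simp add: l'_def n'_def algebra_simps)
  have e1: "- (x1 + x2) + k * (2 * l + a\<^sub>1 E) - k\<^sup>2 = - (x3 + x4)"
    using q1 k by Groebner_Basis.algebra
  have e0: "x1 * x2 + k * (2 * n + a\<^sub>3 E) + k\<^sup>2 * x5 = x3 * x4"
    using q0 k by Groebner_Basis.algebra
  have "line_meets E l' n' x5 x3 x4"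
    unfolding line_meets_def
  proof (intro conjI)
    show "l'\<^sup>2 + a\<^sub>1 E * l' - a\<^sub>2 E = x5 + x3 + x4"
      using L e1 unfolding line_meets_def l'_def by Groebner_Basis.algebra
    show "2 * l' * n' + a\<^sub>1 E * n' + a\<^sub>3 E * l' - a\<^sub>4 E = - (x5 * x3 + x5 * x4 + x3 * x4)"
      using L e1 e0 unfolding line_meets_def l'_def n'_def by Groebner_Basis.algebra
    show "n'\<^sup>2 + a\<^sub>3 E * n' - a\<^sub>6 E = x5 * x3 * x4"
      using L e0 unfolding line_meets_def n'_def by Groebner_Basis.algebra
  qed
  moreover have "\<not> (x5 = x3 \<and> (l' * x5 + n') + (l' * x3 + n') + a\<^sub>1 E * x3 + a\<^sub>3 E = 0)"
  proof
    assume a: "x5 = x3 \<and> (l' * x5 + n') + (l' * x3 + n') + a\<^sub>1 E * x3 + a\<^sub>3 E = 0"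
    then have "(l' * x3 + n') + (l' * x3 + n') + a\<^sub>1 E * x3 + a\<^sub>3 E = 0" "x5 = x3" by metis+
    then have "q x3 = l * x5 + n"
      unfolding y3[symmetric] l'_def n'_def by Groebner_Basis.algebra
    with a ne show False by simp
  qed
  ultimately show ?thesis
    unfolding y5 y3[symmetric] y4[symmetric] by (rule point_add_line)
qed

text \<open>One parabola passes through all three points, and it can be written with the line
  through P, Q or with the line through Q, R as its linear part. Both ways of adding therefore end
  in the reflection of the same fourth intersection. The points P and Q may coincide, in which case
  the line is a tangent.\<close>

lemma point_add_assoc_generic:
  assumes P: "on_curve E (Affine x1 y1)" and Q: "on_curve E (Affine x2 y2)"
    and R: "on_curve E (Affine x3 y3)" and x: "x3 \<noteq> x1" "x3 \<noteq> x2"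
    and PQ: "point_add E (Affine x1 y1) (Affine x2 y2) \<noteq> Infinity"
    and PQR: "point_add E (Affine x1 y1) (Affine x2 y2) \<noteq> point_neg E (Affine x3 y3)"
    and QRP: "point_add E (Affine x2 y2) (Affine x3 y3) \<noteq> point_neg E (Affine x1 y1)"
  shows "point_add E (point_add E (Affine x1 y1) (Affine x2 y2)) (Affine x3 y3) =
    point_add E (point_add E (Affine x2 y2) (Affine x3 y3)) (Affine x1 y1)"
  using P Q
proof (cases rule: point_add_line_cases)
  case opposite
  then show ?thesis using PQ unfolding point_add_eq_Infinity_iff by blast
next
  case (line l n x5)
  define D where "D = (x3 - x1) * (x3 - x2)"
  have D: "D \<noteq> 0" using x by (simp add: D_def)
  define m where "m = (y3 - l * x3 - n) / D"
  have y3: "y3 = l * x3 + n + m * (x3 - x1) * (x3 - x2)"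
    using D by (simp add: m_def D_def[symmetric] mult.assoc)
  define q where "q = (\<lambda>x. l * x + n + m * (x - x1) * (x - x2))"
  \<comment> \<open>For \<open>m = 0\<close> the point R would lie on the line through P and Q,
    hence be its third intersection - (P + Q), which is excluded.\<close>
  have m: "m \<noteq> 0"
  proof
    assume m: "m = 0"
    have "- (D * (x3 - x5)) = 0"
      using R line_meets_eval[OF line(1), of x3] unfolding y3 m D_def on_curve.simps by simp
    then have "x3 = x5" using D by simp
    then show False using PQR line(4) y3 m by simp
  qed
  \<comment> \<open>Solved from the linear coefficient \<open>q1\<close>. The constant coefficient
    \<open>q0\<close> then follows because R lies on the curve and the factor \<open>D\<close> can
    be cancelled.\<close>
  define x4 where "x4 = x1 + x2 - x3 - (2 * l + a\<^sub>1 E) / m + 1 / m\<^sup>2"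
  have q1: "- (m\<^sup>2 * (x1 + x2)) + m * (2 * l + a\<^sub>1 E) - 1 = - (m\<^sup>2 * (x3 + x4))"
    using m by (simp add: x4_def field_simps power2_eq_square)
  have "D * (m\<^sup>2 * x1 * x2 + m * (2 * n + a\<^sub>3 E) + x5 - m\<^sup>2 * x3 * x4) = 0"
    using R line_meets_eval[OF line(1), of x3] q1 unfolding y3 D_def on_curve.simps by Groebner_Basis.algebra
  then have q0: "m\<^sup>2 * x1 * x2 + m * (2 * n + a\<^sub>3 E) + x5 = m\<^sup>2 * x3 * x4" using D by simp
  have left: "point_add E (point_neg E (Affine x5 (l * x5 + n))) (Affine x3 (q x3)) =
    point_neg E (Affine x4 (q x4))"
    unfolding q_def using PQR[unfolded line(4)] y3
    by (intro point_add_parabola[OF line(1) m q1 q0]) auto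
  \<comment> \<open>The same parabola with base points \<open>x2\<close>, \<open>x3\<close> in place
    of \<open>x1\<close>, \<open>x2\<close>; \<open>x6\<close> is solved from the condition on the
    constant coefficient for this form.\<close>
  define l' n' x6 where "l' = l + m * (x3 - x1)" and "n' = n + m * x2 * (x1 - x3)"
    and "x6 = m\<^sup>2 * x1 * x4 - m\<^sup>2 * x2 * x3 - m * (2 * n' + a\<^sub>3 E)"
  have q': "q = (\<lambda>x. l' * x + n' + m * (x - x2) * (x - x3))"
    by (auto simp: q_def l'_def n'_def algebra_simps)
  have L': "line_meets E l' n' x2 x3 x6"
    using line(1) q1 q0 unfolding line_meets_def x6_def n'_def l'_def by Groebner_Basis.algebra
  have y2: "y2 = l' * x2 + n'" and y3': "y3 = l' * x3 + n'"
    unfolding line(3) y3 l'_def n'_def by Groebner_Basis.algebra+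
  have sum: "point_add E (Affine x2 y2) (Affine x3 y3) = point_neg E (Affine x6 (l' * x6 + n'))"
    unfolding y2 y3' using x by (intro point_add_line[OF L']) auto
  have "point_add E (point_neg E (Affine x6 (l' * x6 + n'))) (Affine x1 (q x1)) =
    point_neg E (Affine x4 (q x4))"
    unfolding q'
  proof (rule point_add_parabola[OF L' m])
    show "- (m\<^sup>2 * (x2 + x3)) + m * (2 * l' + a\<^sub>1 E) - 1 = - (m\<^sup>2 * (x1 + x4))"
      using q1 unfolding l'_def by Groebner_Basis.algebra
    show "m\<^sup>2 * x2 * x3 + m * (2 * n' + a\<^sub>3 E) + x6 = m\<^sup>2 * x1 * x4"
      by (simp add: x6_def)
    have "q x1 = y1" by (simp add: q_def line(2))
    then show "Affine x1 (l' * x1 + n' + m * (x1 - x2) * (x1 - x3)) \<noteq> Affine x6 (l' * x6 + n')"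
      using QRP[unfolded sum] unfolding q' by (metis point_neg_neg)
  qed
  moreover have "q x1 = y1" "q x3 = y3" by (simp_all add: q_def line(2) y3)
  ultimately show ?thesis using left unfolding sum line(4) by simp
qed

section \<open>Existence of points in general position\<close>

lemma infinite_UNIV_alg_closed: "infinite (UNIV :: 'k::alg_closed_field set)"
proof
  assume fin: "finite (UNIV :: 'k set)"
  define q :: "'k poly" where "q = (\<Prod>x\<in>UNIV. [:- x, 1:])"
  have "degree q = card (UNIV :: 'k set)"
    unfolding q_def by (subst degree_prod_sum_eq) auto
  then have "degree q > 0" using fin by (simp add: card_gt_0_iff)
  \<comment> \<open>The polynomial \<open>q\<close> vanishes everywhere, so \<open>q + 1\<close> is
    nonconstant without a root.\<close>
  then have "degree (q + 1) > 0" by (subst degree_add_eq_left) simp_all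
  then obtain z where "poly (q + 1) z = 0" using alg_closed_imp_poly_has_root by blast
  moreover have "poly q z = 0" unfolding q_def poly_prod using fin by (auto simp: prod_zero_iff)
  ultimately show False by simp
qed

lemma exists_point_over:
  fixes E :: "'k::alg_closed_field weierstrass"
  shows "\<exists>y. on_curve E (Affine x y)"
proof -
  have "\<exists>y. poly [:- (x ^ 3 + a\<^sub>2 E * x\<^sup>2 + a\<^sub>4 E * x + a\<^sub>6 E), a\<^sub>1 E * x + a\<^sub>3 E, 1:] y = 0"
    by (rule alg_closed_imp_poly_has_root) simp
  then show ?thesis by (auto simp: power2_eq_square algebra_simps)
qed

lemma infinite_points: "infinite {P. on_curve (E :: 'k::alg_closed_field weierstrass) P}"
proof
  assume "finite {P. on_curve E P}"
  then have fin: "finite ((\<lambda>P. case P of Affine x y \<Rightarrow> x | Infinity \<Rightarrow> 0) ` {P. on_curve E P})" by simp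
  have "UNIV \<subseteq> (\<lambda>P. case P of Affine x y \<Rightarrow> x | Infinity \<Rightarrow> 0) ` {P. on_curve E P}"
  proof
    fix x :: 'k
    obtain y where "on_curve E (Affine x y)" using exists_point_over by blast
    then show "x \<in> (\<lambda>P. case P of Affine x y \<Rightarrow> x | Infinity \<Rightarrow> 0) ` {P. on_curve E P}"
      by (intro image_eqI[of _ _ "Affine x y"]) auto
  qed
  from finite_subset[OF this fin] show False using infinite_UNIV_alg_closed by blast
qed

lemma same_abscissa:
  assumes "on_curve E (Affine x y)" "on_curve E (Affine x y')"
  shows "Affine x y' = Affine x y \<or> Affine x y' = point_neg E (Affine x y)"
proof -
  have "(y' - y) * (y' - (- y - a\<^sub>1 E * x - a\<^sub>3 E)) = 0"
    using assms unfolding on_curve.simps by Groebner_Basis.algebra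
  then show ?thesis by auto
qed

text \<open>For fixed M and N with M + N not the identity, the hypotheses of the generic case fail
  only for the seven explicit points V listed below. If a summand or M + N is the identity,
  cancellation gives the equation for every V.\<close>

lemma point_add_assoc_almost_all:
  assumes ns: "nonsingular E" and M: "on_curve E M" and N: "on_curve E N"
  shows "finite {V. on_curve E V \<and>
    point_add E (point_add E M N) V \<noteq> point_add E M (point_add E N V)}" (is "finite ?bad")
proof (cases "M = Infinity \<or> N = Infinity \<or> point_add E M N = Infinity")
  case True
  have "?bad = {}"
  proof (cases "M = Infinity \<or> N = Infinity")
    case True
    then show ?thesis by auto
  next
    case False
    then have MN: "point_add E M N = Infinity" using True by blast
    then have N': "N = point_neg E M" by (simp only: point_add_eq_Infinity_iff)
    have "point_add E M (point_add E N V) = V" if V: "on_curve E V" for V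
    proof -
      have "point_add E M (point_add E N V) = point_add E (point_add E V N) (point_neg E N)"
        using M N V point_add_commute on_curve_add unfolding N' by (metis on_curve_neg point_neg_neg)
      then show ?thesis using point_add_neg_cancel[OF ns V N] by simp
    qed
    then show ?thesis using MN by auto
  qed
  then show ?thesis by (simp only: finite.emptyI)
next
  case False
  obtain x1 y1 x2 y2 where MN: "M = Affine x1 y1" "N = Affine x2 y2"
    using False by (cases M; cases N) auto
  have "?bad \<subseteq> {Infinity, M, point_neg E M, N, point_neg E N, point_neg E (point_add E M N),
      point_add E (point_neg E M) (point_neg E N)}"
  proof
    fix V assume V: "V \<in> ?bad"
    show "V \<in> {Infinity, M, point_neg E M, N, point_neg E N, point_neg E (point_add E M N),
      point_add E (point_neg E M) (point_neg E N)}"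
    proof (rule ccontr)
      assume nV: "V \<notin> {Infinity, M, point_neg E M, N, point_neg E N, point_neg E (point_add E M N),
        point_add E (point_neg E M) (point_neg E N)}"
      then obtain x3 y3 where V': "V = Affine x3 y3" by (cases V) auto
      have c: "on_curve E V" "on_curve E (point_add E N V)"
        using V N on_curve_add by auto
      have x: "x3 \<noteq> x1" "x3 \<noteq> x2"
        using same_abscissa[of E x1 y1 y3] same_abscissa[of E x2 y2 y3] M N c nV unfolding MN V' by blast+
      have "point_add E N V \<noteq> point_neg E M"
      proof
        assume "point_add E N V = point_neg E M"
        then have "point_add E V N = point_neg E M" using point_add_commute N c by metis
        then have "V = point_add E (point_neg E M) (point_neg E N)"
          using point_add_neg_cancel[OF ns c(1) N] by simp
        then show False using nV by blast
      qed
      moreover have "point_add E M N \<noteq> point_neg E V" using nV by (metis insertCI point_neg_neg)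
      ultimately have "point_add E (point_add E M N) V = point_add E (point_add E N V) M"
        using M N c(1) False x unfolding MN V' by (intro point_add_assoc_generic) auto
      also have "\<dots> = point_add E M (point_add E N V)" using point_add_commute c(2) M by blast
      finally show False using V by simp
    qed
  qed
  then show ?thesis by (rule finite_subset) simp
qed

text \<open>
  Adding a sufficiently general point \<open>U\<close> to both sides reduces associativity to the generic case.
\<close>

lemma point_add_assoc:
  fixes E :: "'k::alg_closed_field weierstrass"
  assumes ns: "nonsingular E" and P: "on_curve E P" and Q: "on_curve E Q" and R: "on_curve E R"
  shows "point_add E (point_add E P Q) R = point_add E P (point_add E Q R)"
proof -
  define bad where "bad = (\<lambda>M N. {V. on_curve E V \<and>
    point_add E (point_add E M N) V \<noteq> point_add E M (point_add E N V)})"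
  have fin: "finite (bad M N)" if "on_curve E M" "on_curve E N" for M N
    unfolding bad_def using point_add_assoc_almost_all[OF ns that] .
  have PQ: "on_curve E (point_add E P Q)" and QR: "on_curve E (point_add E Q R)"
    using P Q R on_curve_add by blast+
  \<comment> \<open>U has to permit four regroupings, leading from ((P + Q) + R) + U through (P + Q)
    + (R + U), P + (Q + (R + U)) and P + ((Q + R) + U) to (P + (Q + R)) + U. The second one
    restricts R + U, so its bad set is translated by - R.\<close>
  have "infinite ({V. on_curve E V} - (bad (point_add E P Q) R \<union> bad Q R \<union> bad P (point_add E Q R) \<union>
    (\<lambda>S. point_add E S (point_neg E R)) ` bad P Q))"
    using fin P Q R PQ QR infinite_points by (intro Diff_infinite_finite) auto
  from infinite_imp_nonempty[OF this] obtain U where U: "on_curve E U" and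
    U': "U \<notin> bad (point_add E P Q) R" "U \<notin> bad Q R" "U \<notin> bad P (point_add E Q R)"
      "U \<notin> (\<lambda>S. point_add E S (point_neg E R)) ` bad P Q"
    by blast
  have RU: "on_curve E (point_add E R U)" using R U on_curve_add by blast
  have "point_add E R U \<notin> bad P Q"
  proof
    assume b: "point_add E R U \<in> bad P Q"
    have "U = point_add E (point_add E R U) (point_neg E R)"
      using point_add_neg_cancel[OF ns U R] point_add_commute[OF U R] by simp
    with b U'(4) show False by blast
  qed
  then have "point_add E (point_add E P Q) (point_add E R U) =
      point_add E P (point_add E Q (point_add E R U))"
    using RU by (simp add: bad_def)
  then have eq: "point_add E (point_add E (point_add E P Q) R) U =
      point_add E (point_add E P (point_add E Q R)) U"
    using U U' by (simp add: bad_def)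
  have c: "on_curve E (point_add E (point_add E P Q) R)" "on_curve E (point_add E P (point_add E Q R))"
    using PQ QR P R on_curve_add by blast+
  show ?thesis
    using point_add_neg_cancel[OF ns c(1) U] point_add_neg_cancel[OF ns c(2) U] unfolding eq by simp
qed

section \<open>The abelian group of all points\<close>

lemma in_points_UNIV [simp]: "P \<in> points UNIV E \<longleftrightarrow> on_curve E P"
  by (cases P) (simp_all add: points_def)

lemma point_group_simps:
  "carrier (point_group UNIV E) = {P. on_curve E P}"
  "P \<otimes>\<^bsub>point_group L E\<^esub> Q = point_add E P Q"
  "\<one>\<^bsub>point_group L E\<^esub> = Infinity"
  by (auto simp: point_group_def)

lemma comm_group_point_group:
  fixes E :: "'k::alg_closed_field weierstrass"
  assumes "nonsingular E"
  shows "comm_group (point_group UNIV E)"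
proof (rule comm_groupI)
  fix P
  assume "P \<in> carrier (point_group UNIV E)"
  then show "\<exists>Q \<in> carrier (point_group UNIV E). Q \<otimes>\<^bsub>point_group UNIV E\<^esub> P = \<one>\<^bsub>point_group UNIV E\<^esub>"
    by (intro bexI[of _ "point_neg E P"]) (simp_all add: point_group_simps point_add_eq_Infinity_iff)
next
  fix P Q
  assume "P \<in> carrier (point_group UNIV E)" "Q \<in> carrier (point_group UNIV E)"
  then show "P \<otimes>\<^bsub>point_group UNIV E\<^esub> Q = Q \<otimes>\<^bsub>point_group UNIV E\<^esub> P"
    unfolding point_group_simps by (intro point_add_commute) simp_all
qed (simp_all add: point_group_simps on_curve_add point_add_assoc[OF assms])

lemma inv_point_group:
  fixes E :: "'k::alg_closed_field weierstrass"
  assumes "nonsingular E" "on_curve E P"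
  shows "inv\<^bsub>point_group UNIV E\<^esub> P = point_neg E P"
proof -
  interpret G: comm_group "point_group UNIV E" by (rule comm_group_point_group[OF assms(1)])
  show ?thesis
    using assms(2) by (intro G.inv_equality) (simp_all add: point_group_simps point_add_eq_Infinity_iff)
qed

section \<open>Torsion points, Frobenius and point counts\<close>

text \<open>Completing the square: an affine point is its own negative iff its ordinate is
  \<open>y x\<close>, and such a point is on the curve iff x is a root of the 2-division polynomial
  \<open>g\<close>. A multiple root would be the abscissa of a singular point, so there are three
  roots, and the point at infinity is the fourth element.\<close>

lemma card_double_eq_Infinity:
  fixes E :: "'k::alg_closed_field weierstrass"
  assumes ns: "nonsingular E" and two: "(2 :: 'k) \<noteq> 0"
  shows "card {P. on_curve E P \<and> point_add E P P = Infinity} = 4"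
proof -
  have four: "(4 :: 'k) \<noteq> 0"
  proof -
    have "(4 :: 'k) = 2 * 2" by simp
    then show ?thesis using no_zero_divisors[OF two two] by metis
  qed
  define b2 b4 b6 where "b2 = (a\<^sub>1 E)\<^sup>2 + 4 * a\<^sub>2 E" and "b4 = 2 * a\<^sub>4 E + a\<^sub>1 E * a\<^sub>3 E"
    and "b6 = (a\<^sub>3 E)\<^sup>2 + 4 * a\<^sub>6 E"
  define g where "g = [:b6, 2 * b4, b2, 4:]"
  define y where "y = (\<lambda>x. - (a\<^sub>1 E * x + a\<^sub>3 E) / 2)"
  have y: "2 * y x = - (a\<^sub>1 E * x + a\<^sub>3 E)" for x using two by (simp add: y_def)
  have on: "on_curve E (Affine x (y x)) \<longleftrightarrow> poly g x = 0" for x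
  proof -
    have *: "4 * ((y x)\<^sup>2 + a\<^sub>1 E * x * y x + a\<^sub>3 E * y x - (x ^ 3 + a\<^sub>2 E * x\<^sup>2 + a\<^sub>4 E * x + a\<^sub>6 E)) =
        - (b6 + x * (2 * b4 + x * (b2 + x * 4)))"
      unfolding b2_def b4_def b6_def using y[of x] by Groebner_Basis.algebra
    have "on_curve E (Affine x (y x)) \<longleftrightarrow> 4 * ((y x)\<^sup>2 + a\<^sub>1 E * x * y x + a\<^sub>3 E * y x -
        (x ^ 3 + a\<^sub>2 E * x\<^sup>2 + a\<^sub>4 E * x + a\<^sub>6 E)) = 0"
      unfolding on_curve.simps mult_eq_0_iff right_minus_eq using four by (simp only: simp_thms)
    also have "\<dots> \<longleftrightarrow> poly g x = 0"
      unfolding * neg_equal_0_iff_equal by (simp add: g_def)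
    finally show ?thesis .
  qed
  have "degree g = 3" "lead_coeff g = 4" using four by (simp_all add: g_def)
  moreover have "g \<noteq> 0" using four by (simp add: g_def)
  ultimately obtain M where M: "size M = 3" "g = smult 4 (\<Prod>x\<in>#M. [:- x, 1:])"
    using alg_closed_imp_factorization[of g] by auto
  obtain rs where rs: "mset rs = M" using ex_mset by blast
  then have "length rs = 3" using M(1) by (metis size_mset)
  then obtain r1 r2 r3 where "rs = [r1, r2, r3]"
    by (auto simp: numeral_eq_Suc length_Suc_conv)
  then have "M = {#r1, r2, r3#}" using rs by auto
  then have g: "g = smult 4 ([:- r1, 1:] * ([:- r2, 1:] * [:- r3, 1:]))" using M by simp
  have b: "b2 = - 4 * (r1 + r2 + r3)" "2 * b4 = 4 * (r1 * r2 + r1 * r3 + r2 * r3)" "b6 = - 4 * r1 * r2 * r3"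
    using g unfolding g_def by (simp_all add: algebra_simps)
  have double: False
    if e: "b2 = - 4 * (r + r + s)" "2 * b4 = 4 * (r * r + r * s + r * s)" "b6 = - 4 * r * r * s" for r s
  proof -
    have "b6 + r * (2 * b4 + r * (b2 + r * 4)) = 0" unfolding e by Groebner_Basis.algebra
    then have c: "on_curve E (Affine r (y r))" unfolding on by (simp add: g_def)
    \<comment> \<open>Up to sign the left side is the derivative of \<open>g\<close> at the double
      root \<open>r\<close>.\<close>
    have "4 * (a\<^sub>1 E * y r - (3 * r\<^sup>2 + 2 * a\<^sub>2 E * r + a\<^sub>4 E)) = 0"
      using e(1,2) y[of r] unfolding b2_def b4_def by Groebner_Basis.algebra
    then have "a\<^sub>1 E * y r = 3 * r\<^sup>2 + 2 * a\<^sub>2 E * r + a\<^sub>4 E"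
      unfolding mult_eq_0_iff right_minus_eq using four by (simp only: simp_thms)
    moreover have "2 * y r + a\<^sub>1 E * r + a\<^sub>3 E = 0" using y[of r] by Groebner_Basis.algebra
    ultimately show False using ns c unfolding nonsingular_def by blast
  qed
  have "r1 \<noteq> r2" using double[of r1 r3] b by auto
  moreover have "r1 \<noteq> r3" using double[of r1 r2] b by (auto simp: algebra_simps)
  moreover have "r2 \<noteq> r3" using double[of r2 r1] b by (auto simp: algebra_simps)
  moreover have "{P. on_curve E P \<and> point_add E P P = Infinity} =
      insert Infinity ((\<lambda>x. Affine x (y x)) ` {r1, r2, r3})"
  proof (intro Set.set_eqI)
    fix P
    show "P \<in> {P. on_curve E P \<and> point_add E P P = Infinity} \<longleftrightarrow>
        P \<in> insert Infinity ((\<lambda>x. Affine x (y x)) ` {r1, r2, r3})"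
    proof (cases P)
      case (Affine u v)
      have roots: "poly g u = 0 \<longleftrightarrow> u \<in> {r1, r2, r3}" unfolding g poly_smult poly_mult mult_eq_0_iff using four by auto
      have "point_add E P P = Infinity \<longleftrightarrow> v + v + a\<^sub>1 E * u + a\<^sub>3 E = 0"
        unfolding Affine by (simp add: Let_def)
      also have "\<dots> \<longleftrightarrow> 2 * (v - y u) = 0" using y[of u] by Groebner_Basis.algebra
      also have "\<dots> \<longleftrightarrow> v = y u" using two by simp
      finally have "on_curve E P \<and> point_add E P P = Infinity \<longleftrightarrow> v = y u \<and> u \<in> {r1, r2, r3}"
        using on[of u] roots Affine by blast
      then show ?thesis using Affine by auto
    qed simp
  qed
  ultimately show ?thesis by (simp add: card_insert_if)
qed

section \<open>The Frobenius map of a curve over the prime field\<close>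

locale curve_over_prime_field =
  fixes p :: nat and E :: "'k::alg_closed_field weierstrass"
  assumes prime_p: "Factorial_Ring.prime p" and odd_p: "odd p" and char_p: "CHAR('k) = p"
    and curve: "elliptic_curve_over (GF p) E"
begin

definition \<sigma> :: "'k \<Rightarrow> 'k" where "\<sigma> x = x ^ p"

definition frob :: "'k point \<Rightarrow> 'k point" where "frob = map_point \<sigma>"

lemma frob_simps [simp]: "frob Infinity = Infinity" "frob (Affine x y) = Affine (\<sigma> x) (\<sigma> y)"
  by (simp_all add: frob_def)

lemma p_pos: "p > 0" using prime_p prime_gt_0_nat by blast

lemma \<sigma>_add: "\<sigma> (x + y) = \<sigma> x + \<sigma> y"
  unfolding \<sigma>_def using prime_p char_p by (intro freshmans_dream) auto

lemma \<sigma>_minus: "\<sigma> (- x) = - \<sigma> x"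
  unfolding \<sigma>_def using odd_p by (rule power_minus_odd)

lemma \<sigma>_mult: "\<sigma> (x * y) = \<sigma> x * \<sigma> y"
  unfolding \<sigma>_def by (rule power_mult_distrib)

lemma \<sigma>_divide: "\<sigma> (x / y) = \<sigma> x / \<sigma> y"
  unfolding \<sigma>_def by (rule power_divide)

lemma \<sigma>_power: "\<sigma> (x ^ n) = \<sigma> x ^ n"
  unfolding \<sigma>_def by (simp add: mult.commute flip: power_mult)

lemma \<sigma>_diff: "\<sigma> (x - y) = \<sigma> x - \<sigma> y"
  using \<sigma>_add[of x "- y"] by (simp add: \<sigma>_minus)

lemma \<sigma>_0: "\<sigma> 0 = 0" and \<sigma>_1: "\<sigma> 1 = 1"
  unfolding \<sigma>_def using p_pos by simp_all

lemma \<sigma>_of_nat: "\<sigma> (of_nat n) = of_nat n"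
  by (induction n) (simp_all add: \<sigma>_0 \<sigma>_1 \<sigma>_add)

lemma \<sigma>_numeral: "\<sigma> (numeral n) = numeral n"
  using \<sigma>_of_nat[of "numeral n"] by simp

lemma \<sigma>_eq_0: "\<sigma> x = 0 \<longleftrightarrow> x = 0"
  unfolding \<sigma>_def using p_pos by simp

lemma \<sigma>_eq: "\<sigma> x = \<sigma> y \<longleftrightarrow> x = y"
  using \<sigma>_eq_0[of "x - y"] by (simp add: \<sigma>_diff)

lemma \<sigma>_coeff: "\<sigma> (a\<^sub>1 E) = a\<^sub>1 E" "\<sigma> (a\<^sub>2 E) = a\<^sub>2 E" "\<sigma> (a\<^sub>3 E) = a\<^sub>3 E" "\<sigma> (a\<^sub>4 E) = a\<^sub>4 E" "\<sigma> (a\<^sub>6 E) = a\<^sub>6 E"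
  using curve unfolding elliptic_curve_over_def GF_def \<sigma>_def by auto

lemmas \<sigma>_simps = \<sigma>_add \<sigma>_minus \<sigma>_mult \<sigma>_divide \<sigma>_power \<sigma>_diff \<sigma>_0 \<sigma>_1 \<sigma>_numeral \<sigma>_coeff

lemma nonsingular: "nonsingular E"
  using curve discriminant_nonzero_imp_nonsingular unfolding elliptic_curve_over_def by blast

lemma two_neq_zero: "(2 :: 'k) \<noteq> 0"
proof
  assume "(2 :: 'k) = 0"
  then have "of_nat 2 = (0 :: 'k)" by simp
  then have "p dvd 2" using char_p unfolding of_nat_eq_0_iff_char_dvd by simp
  then have "p \<le> 2" by (rule dvd_imp_le) simp
  then have "p = 2" using prime_ge_2_nat[OF prime_p] by simp
  then show False using odd_p by simp
qed

lemma on_curve_frob: "on_curve E P \<Longrightarrow> on_curve E (frob P)"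
proof (cases P)
  case (Affine x y)
  assume "on_curve E P"
  then have "\<sigma> (y\<^sup>2 + a\<^sub>1 E * x * y + a\<^sub>3 E * y) = \<sigma> (x ^ 3 + a\<^sub>2 E * x\<^sup>2 + a\<^sub>4 E * x + a\<^sub>6 E)"
    using Affine by simp
  then show ?thesis unfolding Affine by (simp add: \<sigma>_simps)
qed simp

lemma frob_inject: "frob P = frob Q \<longleftrightarrow> P = Q"
  by (cases P; cases Q) (simp_all add: \<sigma>_eq)

lemma frob_add: "frob (point_add E P Q) = point_add E (frob P) (frob Q)"
proof (cases P; cases Q)
  fix x1 y1 x2 y2
  assume PQ: "P = Affine x1 y1" "Q = Affine x2 y2"
  have 1: "\<sigma> y1 + \<sigma> y2 + a\<^sub>1 E * \<sigma> x2 + a\<^sub>3 E = 0 \<longleftrightarrow> y1 + y2 + a\<^sub>1 E * x2 + a\<^sub>3 E = 0"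
    using \<sigma>_eq_0[of "y1 + y2 + a\<^sub>1 E * x2 + a\<^sub>3 E"] by (simp add: \<sigma>_simps)
  show ?thesis unfolding PQ by (simp add: Let_def 1 \<sigma>_eq \<sigma>_simps)
qed simp_all

lemma points_GF_p: "points (GF p) E = {P \<in> points UNIV E. frob P = P}"
proof (intro Set.set_eqI)
  fix P show "P \<in> points (GF p) E \<longleftrightarrow> P \<in> {P \<in> points UNIV E. frob P = P}"
    by (cases P) (auto simp: points_def GF_def \<sigma>_def)
qed

lemma points_GF_p2: "points (GF (p\<^sup>2)) E = {P \<in> points UNIV E. frob (frob P) = P}"
proof (intro Set.set_eqI)
  fix P show "P \<in> points (GF (p\<^sup>2)) E \<longleftrightarrow> P \<in> {P \<in> points UNIV E. frob (frob P) = P}"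
    by (cases P) (auto simp: points_def GF_def \<sigma>_def power2_eq_square power_mult)
qed

section \<open>Point counts on the curve and its quadratic twist\<close>

lemma finite_GF:
  assumes "q > 1"
  shows "finite (GF q :: 'k set)" "card (GF q :: 'k set) \<le> q"
proof -
  define f where "f = monom 1 q + [:0, - 1 :: 'k:]"
  have eq: "(GF q :: 'k set) = {x. poly f x = 0}" by (auto simp: GF_def f_def poly_monom)
  have d: "degree f = q" unfolding f_def using assms by (subst degree_add_eq_left) (auto simp: degree_monom_eq)
  then have "f \<noteq> 0" using assms by auto
  then show "finite (GF q :: 'k set)" "card (GF q :: 'k set) \<le> q"
    unfolding eq using poly_roots_finite card_poly_roots_bound d by metis+
qed

lemma p_gt_1: "p > 1" using prime_p prime_gt_1_nat by blast

text \<open>The p residues embed into the fixed points of Frobenius, while x^p - x has at most p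
  roots.\<close>

lemma card_GF_p: "card (GF p :: 'k set) = p"
proof (rule antisym)
  have "inj_on (of_nat :: nat \<Rightarrow> 'k) {..<p}"
    using char_p by (auto simp: inj_on_def of_nat_eq_iff_cong_CHAR cong_def)
  then have "p = card ((of_nat :: nat \<Rightarrow> 'k) ` {..<p})" by (simp add: card_image)
  also have "\<dots> \<le> card (GF p :: 'k set)"
  proof (rule card_mono)
    show "(of_nat :: nat \<Rightarrow> 'k) ` {..<p} \<subseteq> GF p"
      using \<sigma>_of_nat by (auto simp: GF_def \<sigma>_def)
  qed (use finite_GF p_gt_1 in blast)
  finally show "p \<le> card (GF p :: 'k set)" .
qed (use finite_GF p_gt_1 in blast)

lemma finite_points_GF:
  assumes "q > 1"
  shows "finite (points (GF q) E)"
proof (rule finite_subset)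
  show "points (GF q) E \<subseteq> insert Infinity ((\<lambda>(x, y). Affine x y) ` (GF q \<times> GF q))"
  proof
    fix P assume "P \<in> points (GF q) E"
    then show "P \<in> insert Infinity ((\<lambda>(x, y). Affine x y) ` (GF q \<times> GF q))"
      by (cases P) (auto simp: points_def)
  qed
  show "finite (insert Infinity ((\<lambda>(x, y :: 'k). Affine x y) ` (GF q \<times> GF q)))"
    using finite_GF[OF assms] by simp
qed

text \<open>
  Over each abscissa in \<open>GF p\<close> there are two points with multiplicity, and Frobenius either fixes or
  negates them; the negated ones are the rational points of the quadratic twist.
\<close>

lemma card_fibre:
  assumes x: "x \<in> GF p"
  shows "card {y. on_curve E (Affine x y) \<and> \<sigma> y = y} +
    card {y. on_curve E (Affine x y) \<and> \<sigma> y = - y - a\<^sub>1 E * x - a\<^sub>3 E} = 2"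
proof -
  obtain y0 where y0: "on_curve E (Affine x y0)" using exists_point_over by blast
  define y1 where "y1 = - y0 - a\<^sub>1 E * x - a\<^sub>3 E"
  have \<sigma>x: "\<sigma> x = x" using x by (simp add: GF_def \<sigma>_def)
  have on: "on_curve E (Affine x y) \<longleftrightarrow> y = y0 \<or> y = y1" for y
    using same_abscissa[OF y0, of y] y0 on_curve_neg[of E "Affine x y0"] by (auto simp: y1_def)
  have \<sigma>y1: "\<sigma> y1 = - \<sigma> y0 - a\<^sub>1 E * x - a\<^sub>3 E" by (simp add: y1_def \<sigma>_simps \<sigma>x)
  have "\<sigma> y0 = y0 \<or> \<sigma> y0 = y1" using on_curve_frob[OF y0] on \<sigma>x by simp
  moreover have neg: "- y1 - a\<^sub>1 E * x - a\<^sub>3 E = y0" by (simp add: y1_def)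
  ultimately consider "y0 = y1" "\<sigma> y0 = y0" | "y0 \<noteq> y1" "\<sigma> y0 = y0" "\<sigma> y1 = y1" | "y0 \<noteq> y1" "\<sigma> y0 = y1" "\<sigma> y1 = y0"
    using \<sigma>y1 y1_def by metis
  then show ?thesis
  proof cases
    \<comment> \<open>A ramified abscissa: the only point above it is its own negative and is
      counted once in each set.\<close>
    case 1
    then have *: "{y. on_curve E (Affine x y) \<and> \<sigma> y = y} = {y0}"
      "{y. on_curve E (Affine x y) \<and> \<sigma> y = - y - a\<^sub>1 E * x - a\<^sub>3 E} = {y0}"
      unfolding on using neg by auto
    show ?thesis unfolding * by simp
  next
    case 2
    then have *: "{y. on_curve E (Affine x y) \<and> \<sigma> y = y} = {y0, y1}"
      "{y. on_curve E (Affine x y) \<and> \<sigma> y = - y - a\<^sub>1 E * x - a\<^sub>3 E} = {}"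
      unfolding on using neg y1_def by auto
    show ?thesis unfolding * using 2 by simp
  next
    case 3
    then have *: "{y. on_curve E (Affine x y) \<and> \<sigma> y = y} = {}"
      "{y. on_curve E (Affine x y) \<and> \<sigma> y = - y - a\<^sub>1 E * x - a\<^sub>3 E} = {y0, y1}"
      unfolding on using neg y1_def by auto
    show ?thesis unfolding * using 3 by simp
  qed
qed

lemma card_points_by_abscissa:
  assumes fin: "\<And>x. x \<in> GF p \<Longrightarrow> finite (Y x)"
  shows "card (insert Infinity (\<Union>x \<in> GF p. Affine x ` Y x)) = 1 + (\<Sum>x \<in> (GF p :: 'k set). card (Y x))"
proof -
  have "card (\<Union>x \<in> GF p. Affine x ` Y x) = (\<Sum>x \<in> GF p. card (Affine x ` Y x))"
    using fin finite_GF(1)[OF p_gt_1] by (intro card_UN_disjoint) auto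
  also have "\<dots> = (\<Sum>x \<in> GF p. card (Y x))"
    by (intro sum.cong refl card_image) (auto simp: inj_on_def)
  moreover have "finite (\<Union>x \<in> GF p. Affine x ` Y x)" using fin finite_GF(1)[OF p_gt_1] by simp
  ultimately show ?thesis by (subst card_insert_disjoint) auto
qed

text \<open>Negation preserves abscissae, so points of both kinds lie over \<open>GF p\<close>. Each
  of the p abscissae contributes 2, and the point at infinity belongs to both sets.\<close>

lemma card_fixed_plus_card_antifixed:
  "card {P \<in> points UNIV E. frob P = P} + card {P \<in> points UNIV E. frob P = point_neg E P} = 2 * (p + 1)"
proof -
  define Y Z where "Y = (\<lambda>x. {y. on_curve E (Affine x y) \<and> \<sigma> y = y})"
    and "Z = (\<lambda>x. {y. on_curve E (Affine x y) \<and> \<sigma> y = - y - a\<^sub>1 E * x - a\<^sub>3 E})"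
  have GF: "x \<in> GF p \<longleftrightarrow> \<sigma> x = x" for x by (simp add: GF_def \<sigma>_def)
  have fin: "finite {y. on_curve E (Affine x y)}" for x
  proof -
    obtain y0 where y0: "on_curve E (Affine x y0)" using exists_point_over by blast
    have "{y. on_curve E (Affine x y)} \<subseteq> {y0, - y0 - a\<^sub>1 E * x - a\<^sub>3 E}"
      using same_abscissa[OF y0] by auto
    then show ?thesis by (rule finite_subset) simp
  qed
  have YZ: "finite (Y x)" "finite (Z x)" for x
    unfolding Y_def Z_def using fin[of x] by (auto intro: finite_subset)
  have 1: "{P \<in> points UNIV E. frob P = P} = insert Infinity (\<Union>x \<in> GF p. Affine x ` Y x)"
  proof (intro Set.set_eqI)
    fix P show "P \<in> {P \<in> points UNIV E. frob P = P} \<longleftrightarrow> P \<in> insert Infinity (\<Union>x \<in> GF p. Affine x ` Y x)"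
      by (cases P) (auto simp: points_def GF Y_def)
  qed
  have 2: "{P \<in> points UNIV E. frob P = point_neg E P} = insert Infinity (\<Union>x \<in> GF p. Affine x ` Z x)"
  proof (intro Set.set_eqI)
    fix P show "P \<in> {P \<in> points UNIV E. frob P = point_neg E P} \<longleftrightarrow> P \<in> insert Infinity (\<Union>x \<in> GF p. Affine x ` Z x)"
      by (cases P) (auto simp: points_def GF Z_def)
  qed
  have "(\<Sum>x \<in> (GF p :: 'k set). card (Y x)) + (\<Sum>x \<in> (GF p :: 'k set). card (Z x)) = (\<Sum>x \<in> (GF p :: 'k set). 2)"
    unfolding sum.distrib[symmetric] Y_def Z_def by (intro sum.cong refl card_fibre)
  then show ?thesis
    unfolding 1 2 card_points_by_abscissa[OF YZ(1)] card_points_by_abscissa[OF YZ(2)]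
    by (simp add: card_GF_p)
qed

end

section \<open>Morphisms over the prime field commute with Frobenius\<close>

lemma coords_proportional:
  assumes "coords P = (x, y, z)" "coords Q = (x', y', z')" "c \<noteq> 0" "d \<noteq> 0"
    and "c * x = d * x'" "c * y = d * y'" "c * z = d * z'"
  shows "P = Q"
  using assms by (cases P; cases Q) auto

context curve_over_prime_field
begin

lemma \<sigma>_sum: "\<sigma> (sum f I) = (\<Sum>i\<in>I. \<sigma> (f i))"
  by (induction I rule: infinite_finite_induct) (simp_all add: \<sigma>_simps)

lemma coords_frob: "coords P = (x, y, z) \<Longrightarrow> coords (frob P) = (\<sigma> x, \<sigma> y, \<sigma> z)"
  by (cases P) (auto simp: \<sigma>_simps)

lemma form_at_frob:
  assumes "\<And>i j. F i j \<in> GF p"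
  shows "form_at d F (frob P) = \<sigma> (form_at d F P)"
proof -
  have F: "\<sigma> (F i j) = F i j" for i j using assms by (simp add: GF_def \<sigma>_def)
  obtain x y z where "coords P = (x, y, z)" by (cases "coords P")
  with coords_frob[OF this] show ?thesis by (simp add: form_at_def \<sigma>_sum \<sigma>_simps F)
qed

text \<open>Forms with coefficients in \<open>GF p\<close> commute with \<sigma>. Those that
  represent \<phi> at P therefore have no common zero at \<open>frob P\<close> either, and they
  compute both images; the two coordinate vectors are proportional.\<close>

lemma morphism_frob:
  assumes \<phi>: "morphism_over (GF p) E E' \<phi>" and P: "on_curve E P"
  shows "\<phi> (frob P) = frob (\<phi> P)"
proof -
  have "P \<in> points UNIV E" using P by simp
  from bspec[OF \<phi>[unfolded morphism_over_def, THEN conjunct2] this]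
  obtain d F G H where FGH: "\<forall>i j. F i j \<in> GF p \<and> G i j \<in> GF p \<and> H i j \<in> GF p"
    and nz: "(form_at d F P, form_at d G P, form_at d H P) \<noteq> (0, 0, 0)"
    and val: "\<forall>Q \<in> points UNIV E. (form_at d F Q, form_at d G Q, form_at d H Q) \<noteq> (0, 0, 0) \<longrightarrow>
      (\<exists>c. c \<noteq> 0 \<and> (case coords (\<phi> Q) of (x, y, z) \<Rightarrow>
        form_at d F Q = c * x \<and> form_at d G Q = c * y \<and> form_at d H Q = c * z))"
    by (elim exE conjE) (rule that)
  have fr: "form_at d F (frob P) = \<sigma> (form_at d F P)" "form_at d G (frob P) = \<sigma> (form_at d G P)"
    "form_at d H (frob P) = \<sigma> (form_at d H P)"
    using FGH by (simp_all add: form_at_frob)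
  have nz': "(form_at d F (frob P), form_at d G (frob P), form_at d H (frob P)) \<noteq> (0, 0, 0)"
    using nz unfolding fr by (simp add: \<sigma>_eq_0)
  obtain x y z where xyz: "coords (\<phi> P) = (x, y, z)" by (cases "coords (\<phi> P)")
  obtain x' y' z' where xyz': "coords (\<phi> (frob P)) = (x', y', z')" by (cases "coords (\<phi> (frob P))")
  obtain c where c: "c \<noteq> 0" "form_at d F P = c * x" "form_at d G P = c * y" "form_at d H P = c * z"
    using val P nz xyz by auto
  obtain c' where c': "c' \<noteq> 0" "form_at d F (frob P) = c' * x'" "form_at d G (frob P) = c' * y'"
    "form_at d H (frob P) = c' * z'"
    using val on_curve_frob[OF P] nz' xyz' by auto
  show ?thesis
  proof (rule coords_proportional[OF xyz' coords_frob[OF xyz] c'(1)])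
    show "\<sigma> c \<noteq> 0" using c(1) by (simp add: \<sigma>_eq_0)
    show "c' * x' = \<sigma> c * \<sigma> x" "c' * y' = \<sigma> c * \<sigma> y" "c' * z' = \<sigma> c * \<sigma> z"
      using c c' fr by (simp_all flip: \<sigma>_mult)
  qed
qed

lemma point_group_GF_p2:
  "point_group (GF (p\<^sup>2)) E =
    (point_group UNIV E)\<lparr>carrier := {P \<in> carrier (point_group UNIV E). frob (frob P) = P}\<rparr>"
  unfolding point_group_def points_GF_p2 by simp

end

section \<open>The kernel of an isogeny of degree 2\<close>

text \<open>Two line extensions of the zero space are unfolded; the trailing \<open>\<zero>\<close>
  is the element contributed by that space.\<close>

lemma (in ring) dimension_two_combination:
  assumes "dimension 2 K E"
  obtains v w where "v \<in> carrier R" "w \<in> carrier R"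
    "\<And>x. x \<in> E \<Longrightarrow> \<exists>a \<in> K. \<exists>b \<in> K. x = a \<otimes> v \<oplus> (b \<otimes> w \<oplus> \<zero>)"
proof -
  have "dimension (Suc (Suc 0)) K E" using assms by (simp add: numeral_2_eq_2)
  then obtain v E' where v: "v \<in> carrier R" "dimension (Suc 0) K E'" "E = line_extension K v E'"
    by (cases rule: dimension.cases) auto
  from v(2) obtain w E'' where w: "w \<in> carrier R" "dimension 0 K E''" "E' = line_extension K w E''"
    by (cases rule: dimension.cases) auto
  from w(2) have "E'' = {\<zero>}" by (cases rule: dimension.cases) auto
  then have "\<exists>a \<in> K. \<exists>b \<in> K. x = a \<otimes> v \<oplus> (b \<otimes> w \<oplus> \<zero>)" if "x \<in> E" for x
    using that unfolding v(3) w(3) Bex_def line_extension_mem_iff by blast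
  then show ?thesis using that v(1) w(1) by blast
qed

section \<open>Germs of functions and the degree condition on values\<close>

lemma ring_fun_ring: "ring (fun_ring :: ('k::field point \<Rightarrow> 'k) ring)"
proof (rule ringI)
  show "abelian_group (fun_ring :: ('k point \<Rightarrow> 'k) ring)"
  proof (rule abelian_groupI)
    fix f :: "'k point \<Rightarrow> 'k"
    show "\<exists>g \<in> carrier fun_ring. g \<oplus>\<^bsub>fun_ring\<^esub> f = \<zero>\<^bsub>fun_ring\<^esub>"
      by (intro bexI[of _ "\<lambda>P. - f P"]) (simp_all add: fun_ring_def)
  qed (simp_all add: fun_ring_def algebra_simps)
  show "Group.monoid (fun_ring :: ('k point \<Rightarrow> 'k) ring)"
    by (rule monoidI) (simp_all add: fun_ring_def algebra_simps)
qed (simp_all add: fun_ring_def algebra_simps)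

lemma ideal_almost_zero:
  fixes E :: "'k::alg_closed_field weierstrass"
  shows "ideal (almost_zero E) fun_ring"
proof (rule idealI[OF ring_fun_ring])
  interpret ring "fun_ring :: ('k point \<Rightarrow> 'k) ring" by (rule ring_fun_ring)
  have inv: "\<ominus>\<^bsub>fun_ring\<^esub> f = (\<lambda>P. - f P)" for f :: "'k point \<Rightarrow> 'k"
    by (rule minus_equality) (simp_all add: fun_ring_def)
  show "subgroup (almost_zero E) (add_monoid fun_ring)"
  proof (rule add.subgroupI)
    fix f g assume "f \<in> almost_zero E" "g \<in> almost_zero E"
    then have "finite ({P \<in> points UNIV E. f P \<noteq> 0} \<union> {P \<in> points UNIV E. g P \<noteq> 0})"
      by (simp add: almost_zero_def)
    then show "f \<oplus>\<^bsub>fun_ring\<^esub> g \<in> almost_zero E"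
      unfolding almost_zero_def fun_ring_def mem_Collect_eq ring.simps
      by (rule rev_finite_subset) auto
  next
    fix f assume "f \<in> almost_zero E"
    then show "\<ominus>\<^bsub>fun_ring\<^esub> f \<in> almost_zero E" by (simp add: inv almost_zero_def)
  next
    have "(\<lambda>_. 0) \<in> almost_zero E" by (simp add: almost_zero_def)
    then show "almost_zero E \<noteq> {}" by blast
  qed (simp add: fun_ring_def)
  fix f g :: "'k point \<Rightarrow> 'k"
  assume "f \<in> almost_zero E"
  then have fin: "finite {P \<in> points UNIV E. f P \<noteq> 0}" by (simp add: almost_zero_def)
  show "g \<otimes>\<^bsub>fun_ring\<^esub> f \<in> almost_zero E" "f \<otimes>\<^bsub>fun_ring\<^esub> g \<in> almost_zero E"
    using fin unfolding almost_zero_def fun_ring_def by (auto elim!: rev_finite_subset)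
qed

lemma in_germ_iff: "g \<in> germ E f \<longleftrightarrow> finite {P \<in> points UNIV E. g P \<noteq> f P}"
proof -
  have "g \<in> germ E f \<longleftrightarrow> (\<exists>h \<in> almost_zero E. g = (\<lambda>P. h P + f P))"
    by (auto simp: germ_def a_r_coset_def' fun_ring_def)
  also have "\<dots> \<longleftrightarrow> (\<lambda>P. g P - f P) \<in> almost_zero E"
  proof
    assume "(\<lambda>P. g P - f P) \<in> almost_zero E"
    then show "\<exists>h \<in> almost_zero E. g = (\<lambda>P. h P + f P)" by (rule bexI[rotated]) auto
  qed auto
  finally show ?thesis by (simp add: almost_zero_def)
qed

lemma germ_ring_ops:
  fixes E :: "'k::alg_closed_field weierstrass"
  shows "ring (germ_ring E)"
    and "V \<in> carrier (germ_ring E) \<Longrightarrow> \<exists>f. V = germ E f"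
    and "germ E f \<otimes>\<^bsub>germ_ring E\<^esub> germ E g = germ E (\<lambda>P. f P * g P)"
    and "germ E f \<oplus>\<^bsub>germ_ring E\<^esub> germ E g = germ E (\<lambda>P. f P + g P)"
    and "\<zero>\<^bsub>germ_ring E\<^esub> = germ E (\<lambda>_. 0)"
proof -
  interpret ideal "almost_zero E" fun_ring by (rule ideal_almost_zero)
  show "ring (germ_ring E)" unfolding germ_ring_def by (rule quotient_is_ring)
  show "V \<in> carrier (germ_ring E) \<Longrightarrow> \<exists>f. V = germ E f"
    by (auto simp: germ_ring_def germ_def FactRing_def A_RCOSETS_def')
  show "germ E f \<otimes>\<^bsub>germ_ring E\<^esub> germ E g = germ E (\<lambda>P. f P * g P)"
    using rcoset_mult_add[of f g] by (simp add: germ_ring_def germ_def FactRing_def) (simp add: fun_ring_def)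
  show "germ E f \<oplus>\<^bsub>germ_ring E\<^esub> germ E g = germ E (\<lambda>P. f P + g P)"
    using a_rcos_sum[of f g] by (simp add: germ_ring_def germ_def FactRing_def) (simp add: fun_ring_def)
  show "\<zero>\<^bsub>germ_ring E\<^esub> = germ E (\<lambda>_. 0)"
    by (auto simp: germ_ring_def FactRing_def in_germ_iff) (auto simp: almost_zero_def)
qed

lemma power_in_function_field:
  fixes E :: "'k::alg_closed_field weierstrass"
  assumes L: "0 \<in> L" "1 \<in> L"
  shows "\<exists>t. germ E t \<in> function_field L E \<and> (\<forall>x y. t (Affine x y) = x ^ n)"
proof -
  \<comment> \<open>The forms X^n and Z^n, whose quotient is x^n at affine points, where Z is
    1.\<close>
  define F G :: "nat \<Rightarrow> nat \<Rightarrow> 'k" where "F = (\<lambda>i j. if i = n \<and> j = 0 then 1 else 0)"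
    and "G = (\<lambda>i j. if i = 0 \<and> j = 0 then 1 else 0)"
  have sum0: "(\<Sum>j\<le>m. if j = 0 then c else 0) = c" for m :: nat and c :: 'k by simp
  have F: "form_at n F (Affine x y) = x ^ n" for x y
  proof -
    have "form_at n F (Affine x y) = (\<Sum>i\<le>n. \<Sum>j\<le>n - i. if j = 0 then (if i = n then x ^ n else 0) else 0)"
      unfolding form_at_def F_def coords.simps prod.case by (intro sum.cong refl) auto
    also have "\<dots> = x ^ n" unfolding sum0 by simp
    finally show ?thesis .
  qed
  have G: "form_at n G (Affine x y) = 1" for x y
  proof -
    have "form_at n G (Affine x y) = (\<Sum>i\<le>n. \<Sum>j\<le>n - i. if j = 0 then (if i = 0 then 1 else 0) else 0)"
      unfolding form_at_def G_def coords.simps prod.case by (intro sum.cong refl) auto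
    also have "\<dots> = 1" unfolding sum0 by simp
    finally show ?thesis .
  qed
  obtain y where "on_curve E (Affine 0 y)" using exists_point_over by blast
  then have "\<exists>P \<in> points UNIV E. form_at n G P \<noteq> 0"
    using G by (intro bexI[of _ "Affine 0 y"]) (simp_all add: points_def)
  moreover have "\<forall>i j. F i j \<in> L \<and> G i j \<in> L" using L by (simp add: F_def G_def)
  ultimately have "germ E (\<lambda>P. form_at n F P / form_at n G P) \<in> function_field L E"
    unfolding function_field_def by blast
  then show ?thesis using F G by (intro exI[of _ "\<lambda>P. form_at n F P / form_at n G P"]) simp
qed

text \<open>This turns the degree into a statement on values: v and w represent a spanning pair, the
  coefficients are pullbacks and hence depend on \<phi> P alone, and equality of germs is equality
  off a finite set. The pair v, w is the same for all n.\<close>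

lemma has_degree_two_powers:
  fixes E E' :: "'k::alg_closed_field weierstrass"
  assumes deg: "has_degree L E E' \<phi> 2" and L: "0 \<in> L" "1 \<in> L"
  obtains v w where "\<And>n. \<exists>f g. finite {P \<in> points UNIV E. \<exists>x y. P = Affine x y \<and>
    x ^ n \<noteq> f (\<phi> P) * v P + g (\<phi> P) * w P}"
proof -
  interpret R: ring "germ_ring E" by (rule germ_ring_ops)
  obtain V W where V: "V \<in> carrier (germ_ring E)" "W \<in> carrier (germ_ring E)"
    and VW: "\<And>x. x \<in> function_field L E \<Longrightarrow> \<exists>a \<in> pullback_field L E E' \<phi>. \<exists>b \<in> pullback_field L E E' \<phi>.
      x = a \<otimes>\<^bsub>germ_ring E\<^esub> V \<oplus>\<^bsub>germ_ring E\<^esub> (b \<otimes>\<^bsub>germ_ring E\<^esub> W \<oplus>\<^bsub>germ_ring E\<^esub> \<zero>\<^bsub>germ_ring E\<^esub>)"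
    using R.dimension_two_combination[OF deg[unfolded has_degree_def]] by metis
  obtain v w where vw: "V = germ E v" "W = germ E w" using V germ_ring_ops(2) by metis
  show ?thesis
  proof (rule that)
    fix n
    obtain t where t: "germ E t \<in> function_field L E" "\<And>x y. t (Affine x y) = x ^ n"
      using power_in_function_field[OF L] by blast
    obtain f g where "germ E t = germ E (f \<circ> \<phi>) \<otimes>\<^bsub>germ_ring E\<^esub> germ E v \<oplus>\<^bsub>germ_ring E\<^esub>
        (germ E (g \<circ> \<phi>) \<otimes>\<^bsub>germ_ring E\<^esub> germ E w \<oplus>\<^bsub>germ_ring E\<^esub> germ E (\<lambda>_. 0))"
      using VW[OF t(1)] unfolding vw germ_ring_ops(5) pullback_field_def by blast
    then have "germ E t = germ E (\<lambda>P. f (\<phi> P) * v P + g (\<phi> P) * w P)"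
      unfolding germ_ring_ops by simp
    moreover have "t \<in> germ E t" by (simp add: in_germ_iff)
    ultimately have "finite {P \<in> points UNIV E. t P \<noteq> f (\<phi> P) * v P + g (\<phi> P) * w P}"
      by (simp add: in_germ_iff)
    then show "\<exists>f g. finite {P \<in> points UNIV E. \<exists>x y. P = Affine x y \<and>
        x ^ n \<noteq> f (\<phi> P) * v P + g (\<phi> P) * w P}"
      by (intro exI[of _ f] exI[of _ g], elim rev_finite_subset) (auto simp: t(2))
  qed
qed

text \<open>The Vandermonde matrix of the three values is a product of a 3 by 2 and a 2 by 3 matrix,
  so its determinant vanishes.\<close>

lemma rank_two_vandermonde:
  fixes x1 x2 x3 :: "'k::field"
  assumes "1 = a0 * v1 + b0 * w1" "1 = a0 * v2 + b0 * w2" "1 = a0 * v3 + b0 * w3"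
    and "x1 = a1 * v1 + b1 * w1" "x2 = a1 * v2 + b1 * w2" "x3 = a1 * v3 + b1 * w3"
    and "x1\<^sup>2 = a2 * v1 + b2 * w1" "x2\<^sup>2 = a2 * v2 + b2 * w2" "x3\<^sup>2 = a2 * v3 + b2 * w3"
  shows "x1 = x2 \<or> x1 = x3 \<or> x2 = x3"
proof -
  define D where "D = (\<lambda>s1 s2 s3 t1 t2 t3 u1 u2 u3 :: 'k.
    s1 * (t2 * u3 - t3 * u2) - s2 * (t1 * u3 - t3 * u1) + s3 * (t1 * u2 - t2 * u1))"
  have "D (a0 * v1 + b0 * w1) (a0 * v2 + b0 * w2) (a0 * v3 + b0 * w3)
      (a1 * v1 + b1 * w1) (a1 * v2 + b1 * w2) (a1 * v3 + b1 * w3)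
      (a2 * v1 + b2 * w1) (a2 * v2 + b2 * w2) (a2 * v3 + b2 * w3) = 0"
    unfolding D_def by Groebner_Basis.algebra
  then have "D 1 1 1 x1 x2 x3 (x1\<^sup>2) (x2\<^sup>2) (x3\<^sup>2) = 0" by (simp only: flip: assms)
  then have "(x1 - x2) * ((x1 - x3) * (x2 - x3)) = 0" unfolding D_def by Groebner_Basis.algebra
  then show ?thesis by simp
qed

text \<open>A nonempty fibre of doubling is a coset of the finite 2-torsion group.\<close>

lemma finite_halves:
  fixes E :: "'k::alg_closed_field weierstrass"
  assumes ns: "nonsingular E" and two: "(2 :: 'k) \<noteq> 0"
  shows "finite {P. on_curve E P \<and> point_add E P P = C}"
proof (cases "{P. on_curve E P \<and> point_add E P P = C} = {}")
  case False
  interpret G: comm_group "point_group UNIV E" by (rule comm_group_point_group[OF ns])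
  note simps = point_group_simps[where E = E]
  obtain Q where Q: "on_curve E Q" "point_add E Q Q = C" using False by blast
  have "{P. on_curve E P \<and> point_add E P P = C} \<subseteq>
      (\<lambda>S. point_add E S Q) ` {S. on_curve E S \<and> point_add E S S = Infinity}"
  proof
    fix P assume "P \<in> {P. on_curve E P \<and> point_add E P P = C}"
    then have P: "on_curve E P" "point_add E P P = C" by auto
    define S where "S = P \<otimes>\<^bsub>point_group UNIV E\<^esub> inv\<^bsub>point_group UNIV E\<^esub> Q"
    have c: "P \<in> carrier (point_group UNIV E)" "Q \<in> carrier (point_group UNIV E)"
      using P Q by (simp_all add: simps)
    then have Sc: "S \<in> carrier (point_group UNIV E)" by (simp add: S_def)
    have "S \<otimes>\<^bsub>point_group UNIV E\<^esub> S = (P \<otimes>\<^bsub>point_group UNIV E\<^esub> P) \<otimes>\<^bsub>point_group UNIV E\<^esub>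
        inv\<^bsub>point_group UNIV E\<^esub> (Q \<otimes>\<^bsub>point_group UNIV E\<^esub> Q)"
      using c by (simp add: S_def G.inv_mult G.m_ac)
    also have "P \<otimes>\<^bsub>point_group UNIV E\<^esub> P = Q \<otimes>\<^bsub>point_group UNIV E\<^esub> Q"
      using P Q by (simp add: simps)
    also have "(Q \<otimes>\<^bsub>point_group UNIV E\<^esub> Q) \<otimes>\<^bsub>point_group UNIV E\<^esub>
        inv\<^bsub>point_group UNIV E\<^esub> (Q \<otimes>\<^bsub>point_group UNIV E\<^esub> Q) = \<one>\<^bsub>point_group UNIV E\<^esub>"
      using c by (intro G.r_inv) simp
    finally have "point_add E S S = Infinity" by (simp add: simps)
    moreover have "P = S \<otimes>\<^bsub>point_group UNIV E\<^esub> Q"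
      using c by (simp add: S_def G.m_assoc)
    then have "P = point_add E S Q" by (simp add: simps)
    ultimately show "P \<in> (\<lambda>S. point_add E S Q) ` {S. on_curve E S \<and> point_add E S S = Infinity}"
      using Sc by (auto simp: simps)
  qed
  moreover have "finite {S. on_curve E S \<and> point_add E S S = Infinity}"
    using card_double_eq_Infinity[OF ns two] by (intro card_ge_0_finite) simp
  ultimately show ?thesis by (rule finite_subset[OF _ finite_imageI])
qed (simp only: finite.emptyI)

text \<open>The three translates of a general point P by kernel points have the same image under
  \<phi>, hence the same coefficients in the representations of 1, x and x^2. By the Vandermonde
  argument two of the translates share their abscissa, so they are equal or opposite.\<close>

lemma no_three_kernel_points:
  fixes E E' :: "'k::alg_closed_field weierstrass"
  assumes ns: "nonsingular E" and two: "(2 :: 'k) \<noteq> 0"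
    and deg: "has_degree L E E' \<phi> 2" and L: "0 \<in> L" "1 \<in> L"
    and hom: "\<phi> \<in> hom (point_group UNIV E) (point_group UNIV E')"
    and S: "on_curve E S1" "on_curve E S2" "on_curve E S3"
      "\<phi> S1 = Infinity" "\<phi> S2 = Infinity" "\<phi> S3 = Infinity"
  shows "S1 = S2 \<or> S1 = S3 \<or> S2 = S3"
proof (rule ccontr)
  assume distinct: "\<not> (S1 = S2 \<or> S1 = S3 \<or> S2 = S3)"
  interpret G: comm_group "point_group UNIV E" by (rule comm_group_point_group[OF ns])
  note simps = point_group_simps[where E = E]
  obtain v w where vw: "\<And>n. \<exists>f g. finite {P \<in> points UNIV E. \<exists>x y. P = Affine x y \<and>
      x ^ n \<noteq> f (\<phi> P) * v P + g (\<phi> P) * w P}"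
    using has_degree_two_powers[OF deg L] by blast
  have "\<forall>n. \<exists>fg. finite {P \<in> points UNIV E. \<exists>x y. P = Affine x y \<and>
      x ^ n \<noteq> fst fg (\<phi> P) * v P + snd fg (\<phi> P) * w P}"
  proof
    fix n
    obtain f g where "finite {P \<in> points UNIV E. \<exists>x y. P = Affine x y \<and>
        x ^ n \<noteq> f (\<phi> P) * v P + g (\<phi> P) * w P}"
      using vw by blast
    then show "\<exists>fg. finite {P \<in> points UNIV E. \<exists>x y. P = Affine x y \<and>
        x ^ n \<noteq> fst fg (\<phi> P) * v P + snd fg (\<phi> P) * w P}"
      by (intro exI[of _ "(f, g)"]) simp
  qed
  from choice[OF this] obtain fg where fg: "\<And>n. finite {P \<in> points UNIV E. \<exists>x y. P = Affine x y \<and>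
      x ^ n \<noteq> fst (fg n) (\<phi> P) * v P + snd (fg n) (\<phi> P) * w P}"
    by (elim exE) (blast intro: that)
  define f g where "f n = fst (fg n)" and "g n = snd (fg n)" for n
  define bad where "bad = insert Infinity (\<Union>n \<in> {0, 1, 2 :: nat}. {P \<in> points UNIV E.
    \<exists>x y. P = Affine x y \<and> x ^ n \<noteq> f n (\<phi> P) * v P + g n (\<phi> P) * w P})"
  have "finite bad" unfolding bad_def f_def g_def using fg by blast
  \<comment> \<open>The first union keeps every translate P + S outside \<open>bad\<close>; the
    second excludes 2 P = - (S + S'), the condition for two translates to be opposite.\<close>
  define bad' where "bad' = (\<Union>S \<in> {S1, S2, S3}. (\<lambda>Q. point_add E Q (point_neg E S)) ` bad) \<union>
    (\<Union>C \<in> {point_add E S1 S2, point_add E S1 S3, point_add E S2 S3}.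
      {P. on_curve E P \<and> point_add E P P = point_neg E C})"
  have "finite bad'" unfolding bad'_def using \<open>finite bad\<close> finite_halves[OF ns two] by blast
  then have "infinite ({P. on_curve E P} - bad')" using infinite_points by (rule Diff_infinite_finite)
  then obtain P where P: "on_curve E P" "P \<notin> bad'" using infinite_imp_nonempty by blast
  have pt: "\<exists>x y. point_add E P S = Affine x y \<and> on_curve E (Affine x y) \<and>
      (\<forall>n \<in> {0, 1, 2}. x ^ n = f n (\<phi> P) * v (Affine x y) + g n (\<phi> P) * w (Affine x y))"
    if "S \<in> {S1, S2, S3}" for S
  proof -
    have Sc: "on_curve E S" "\<phi> S = Infinity" using that S by auto
    have PS: "on_curve E (point_add E P S)" by (rule on_curve_add[OF P(1) Sc(1)])
    have nb: "point_add E P S \<notin> bad"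
    proof
      assume "point_add E P S \<in> bad"
      then have "point_add E (point_add E P S) (point_neg E S) \<in> bad'"
        unfolding bad'_def using that by blast
      then show False using P(2) point_add_neg_cancel[OF ns P(1) Sc(1)] by simp
    qed
    then obtain x y where xy: "point_add E P S = Affine x y"
      by (cases "point_add E P S") (auto simp: bad_def)
    have "\<phi> (point_add E P S) = point_add E' (\<phi> P) (\<phi> S)"
      using hom P(1) Sc(1) by (simp add: hom_def point_group_simps)
    then have \<phi>: "\<phi> (Affine x y) = \<phi> P" unfolding xy Sc(2) by simp
    show ?thesis
      using nb PS unfolding xy bad_def by (auto simp: \<phi>)
  qed
  obtain x1 y1 where 1: "point_add E P S1 = Affine x1 y1" "on_curve E (Affine x1 y1)"
    "\<forall>n \<in> {0, 1, 2}. x1 ^ n = f n (\<phi> P) * v (Affine x1 y1) + g n (\<phi> P) * w (Affine x1 y1)"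
    using pt[of S1] by blast
  obtain x2 y2 where 2: "point_add E P S2 = Affine x2 y2" "on_curve E (Affine x2 y2)"
    "\<forall>n \<in> {0, 1, 2}. x2 ^ n = f n (\<phi> P) * v (Affine x2 y2) + g n (\<phi> P) * w (Affine x2 y2)"
    using pt[of S2] by blast
  obtain x3 y3 where 3: "point_add E P S3 = Affine x3 y3" "on_curve E (Affine x3 y3)"
    "\<forall>n \<in> {0, 1, 2}. x3 ^ n = f n (\<phi> P) * v (Affine x3 y3) + g n (\<phi> P) * w (Affine x3 y3)"
    using pt[of S3] by blast
  have "x1 = x2 \<or> x1 = x3 \<or> x2 = x3"
    using 1(3) 2(3) 3(3)
    by (intro rank_two_vandermonde[where ?a0.0 = "f 0 (\<phi> P)" and ?b0.0 = "g 0 (\<phi> P)"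
      and ?a1.0 = "f 1 (\<phi> P)" and ?b1.0 = "g 1 (\<phi> P)" and ?a2.0 = "f 2 (\<phi> P)" and ?b2.0 = "g 2 (\<phi> P)"
      and ?v1.0 = "v (Affine x1 y1)" and ?w1.0 = "w (Affine x1 y1)"
      and ?v2.0 = "v (Affine x2 y2)" and ?w2.0 = "w (Affine x2 y2)"
      and ?v3.0 = "v (Affine x3 y3)" and ?w3.0 = "w (Affine x3 y3)"]) simp_all
  moreover have neq: "x \<noteq> x'"
    if xy: "point_add E P S = Affine x y" "point_add E P S' = Affine x' y'"
      and SS: "on_curve E S" "on_curve E S'" "S \<noteq> S'"
      and C: "point_add E S S' \<in> {point_add E S1 S2, point_add E S1 S3, point_add E S2 S3}" for S S' x x' y y'
  proof
    assume "x = x'"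
    then have "point_add E P S' = point_add E P S \<or> point_add E P S' = point_neg E (point_add E P S)"
      using same_abscissa[of E x y y'] xy on_curve_add[OF P(1) SS(1)] on_curve_add[OF P(1) SS(2)] by simp
    then show False
    proof
      assume "point_add E P S' = point_add E P S"
      then have "S' = S"
        using G.l_cancel[of P S' S] P(1) SS by (simp add: simps)
      then show False using SS(3) by simp
    next
      assume "point_add E P S' = point_neg E (point_add E P S)"
      then have "point_add E (point_add E P S) (point_add E P S') = Infinity"
        by (simp only: point_add_eq_Infinity_iff)
      moreover have "point_add E (point_add E P S) (point_add E P S') = point_add E (point_add E S S') (point_add E P P)"
        using G.m_ac P(1) SS by (simp add: simps on_curve_add)
      ultimately have "point_add E P P = point_neg E (point_add E S S')"
        by (simp only: point_add_eq_Infinity_iff)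
      then have "P \<in> bad'" unfolding bad'_def using C P(1) by blast
      then show False using P(2) by blast
    qed
  qed
  ultimately show False
    using neq[OF 1(1) 2(1)] neq[OF 1(1) 3(1)] neq[OF 2(1) 3(1)] S(1-3) distinct by blast
qed

section \<open>Abelian groups with a Frobenius endomorphism\<close>

lemma (in group) pow_card_subgroup_eq_one:
  assumes "subgroup H G" "x \<in> H"
  shows "x [^] card H = \<one>"
proof -
  interpret H: group "G\<lparr>carrier := H\<rparr>" using assms(1) subgroup_imp_group by blast
  have "x [^]\<^bsub>G\<lparr>carrier := H\<rparr>\<^esub> Coset.order (G\<lparr>carrier := H\<rparr>) = \<one>"
    using H.pow_order_eq_1[of x] assms by simp
  then show ?thesis by (simp add: Coset.order_def flip: nat_pow_consistent)
qed

text \<open>The model is the group of all points with its Frobenius map: \<open>fixed_sq\<close> is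
  the group of points over F_{p^2}, and \<open>antifixed\<close> is the group of rational points of
  the quadratic twist.\<close>

locale frobenius_group = comm_group G for G (structure) +
  fixes F :: "'a \<Rightarrow> 'a"
  assumes F_hom: "F \<in> hom G G"
    and F_inj: "inj_on F (carrier G)"
    and card_torsion: "card {x \<in> carrier G. x \<otimes> x = \<one>} = 4"
    and finite_fixed_sq: "finite {x \<in> carrier G. F (F x) = x}"
begin

abbreviation "torsion \<equiv> {x \<in> carrier G. x \<otimes> x = \<one>}"
abbreviation "fixed \<equiv> {x \<in> carrier G. F x = x}"
abbreviation "antifixed \<equiv> {x \<in> carrier G. F x = inv x}"
abbreviation "fixed_sq \<equiv> {x \<in> carrier G. F (F x) = x}"

lemma F_closed [simp]: "x \<in> carrier G \<Longrightarrow> F x \<in> carrier G"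
  using F_hom by (auto simp: hom_def)

lemma F_mult [simp]: "x \<in> carrier G \<Longrightarrow> y \<in> carrier G \<Longrightarrow> F (x \<otimes> y) = F x \<otimes> F y"
  using F_hom by (auto simp: hom_def)

lemma F_one [simp]: "F \<one> = \<one>"
  using F_hom by (simp add: hom_one is_group)

lemma F_inv [simp]: "x \<in> carrier G \<Longrightarrow> F (inv x) = inv (F x)"
  using F_hom by (simp add: group_hom.hom_inv group_hom_def group_hom_axioms_def is_group)

lemma F_eq_iff [simp]: "x \<in> carrier G \<Longrightarrow> y \<in> carrier G \<Longrightarrow> F x = F y \<longleftrightarrow> x = y"
  using F_inj by (auto simp: inj_on_def)

lemma subgroup_torsion: "subgroup torsion G"
proof (rule subgroupI)
  fix a b assume a: "a \<in> torsion" and b: "b \<in> torsion"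
  have "inv a \<otimes> inv a = inv (a \<otimes> a)" using a by (subst inv_mult) auto
  then show "inv a \<in> torsion" using a by auto
  have "(a \<otimes> b) \<otimes> (a \<otimes> b) = (a \<otimes> a) \<otimes> (b \<otimes> b)" using a b by (auto simp: m_ac simp del: m_comm)
  then show "a \<otimes> b \<in> torsion" using a b by auto
qed auto

lemma subgroup_fixed: "subgroup fixed G" by (rule subgroupI) auto

lemma subgroup_antifixed: "subgroup antifixed G"
  by (rule subgroupI) (auto simp: inv_mult)

lemma subgroup_fixed_sq: "subgroup fixed_sq G" by (rule subgroupI) auto

lemma fixed_sq_pow: "x \<in> fixed_sq \<Longrightarrow> x [^] (n :: nat) \<in> fixed_sq"
  by (induction n) auto

lemma torsion_cases:
  assumes "T \<in> torsion" "T \<noteq> \<one>"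
  obtains S where "S \<in> torsion" "S \<noteq> \<one>" "S \<noteq> T" "S \<otimes> T \<noteq> \<one>" "S \<otimes> T \<noteq> T" "S \<otimes> T \<noteq> S"
    "torsion = {\<one>, T, S, S \<otimes> T}"
proof -
  have fin: "finite torsion" using card_torsion by (intro card_ge_0_finite) simp
  have "\<not> torsion \<subseteq> {\<one>, T}"
  proof
    assume "torsion \<subseteq> {\<one>, T}"
    from card_mono[OF _ this] card_torsion assms(2) show False by simp
  qed
  then obtain S where S: "S \<in> torsion" "S \<noteq> \<one>" "S \<noteq> T" by blast
  have ST: "S \<otimes> T \<in> torsion" using S(1) assms(1) subgroup_torsion by (metis subgroup.m_closed)
  have 1: "S \<otimes> T \<noteq> \<one>"
  proof
    assume "S \<otimes> T = \<one>"
    then show False using inv_equality[of S T] inv_equality[of T T] S assms by auto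
  qed
  have 2: "S \<otimes> T \<noteq> T" "S \<otimes> T \<noteq> S" using S assms by auto
  have "card {\<one>, T, S, S \<otimes> T} = 4" using 1 2 S assms(2) by (simp add: card_insert_if)
  then have "{\<one>, T, S, S \<otimes> T} = torsion"
    using S ST assms card_torsion fin by (intro card_subset_eq) auto
  then show ?thesis using that S 1 2 by metis
qed

text \<open>The order of x divides 4 and \<open>card H = 4 k + 2\<close>, hence divides 2.\<close>

lemma square_eq_one_if_card_mod_4:
  assumes H: "subgroup H G" "card H mod 4 = 2" and x: "x \<in> H" "(x \<otimes> x) \<otimes> (x \<otimes> x) = \<one>"
  shows "x \<otimes> x = \<one>"
proof -
  have c: "x \<in> carrier G" by (rule subgroup.mem_carrier[OF H(1) x(1)])
  define k where "k = card H div 4"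
  have k: "card H = 4 * k + 2" using H(2) mult_div_mod_eq[of 4 "card H"] by (simp add: k_def)
  have x4: "x [^] (4::nat) = \<one>" using x(2) c by (simp add: numeral_eq_Suc m_assoc)
  have "x [^] card H = (x [^] (4::nat)) [^] k \<otimes> x [^] (2::nat)"
    using c by (simp add: k nat_pow_pow nat_pow_mult)
  then have "x [^] (2::nat) = \<one>"
    unfolding pow_card_subgroup_eq_one[OF H(1) x(1)] x4 using c by simp
  then show ?thesis using c by (simp add: numeral_eq_Suc)
qed

text \<open>The assumption says that \<open>fixed_sq\<close> has no element of order 4. Its exponent
  thus divides 2 m, where m is the odd part of its order.\<close>

lemma pow_double_odd_eq_one:
  assumes sq: "\<And>x. x \<in> fixed_sq \<Longrightarrow> (x \<otimes> x) \<otimes> (x \<otimes> x) = \<one> \<Longrightarrow> x \<otimes> x = \<one>"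
  shows "\<exists>m :: nat. odd m \<and> (\<forall>x \<in> fixed_sq. x [^] (2 * m) = \<one>)"
proof -
  have pow: "y \<otimes> y = \<one>" if "y \<in> fixed_sq" "y [^] (2 ^ r :: nat) = \<one>" for y and r :: nat
    using that(2)
  proof (induction r)
    case 0
    then show ?case using that(1) by simp
  next
    case (Suc r)
    show ?case
    proof (cases r)
      case 0
      then show ?thesis using Suc.prems that(1) by (simp add: numeral_eq_Suc)
    next
      case (Suc s)
      \<comment> \<open>The fourth power of \<open>z\<close> is the trivial element
        \<open>y [^] (2 ^ Suc r)\<close>, so \<open>sq\<close> lowers the exponent by one factor
        2.\<close>
      define z where "z = y [^] (2 ^ s :: nat)"
      have z: "z \<in> fixed_sq"
        unfolding z_def by (rule fixed_sq_pow[OF that(1)])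
      have zz: "z \<otimes> z = y [^] (2 ^ r :: nat)"
        unfolding z_def Suc using that(1) by (simp add: nat_pow_mult mult_2)
      have "(z \<otimes> z) \<otimes> (z \<otimes> z) = y [^] (2 ^ Suc r :: nat)"
        unfolding zz using that(1) by (simp add: nat_pow_mult mult_2)
      then have "z \<otimes> z = \<one>" using sq[OF z] Suc.prems by simp
      then show ?thesis using zz Suc.IH by simp
    qed
  qed
  have "card fixed_sq \<noteq> 0"
    using finite_fixed_sq subgroup.one_closed[OF subgroup_fixed_sq] by (auto simp: card_eq_0_iff)
  then obtain r m where m: "card fixed_sq = 2 ^ r * m" "odd m"
    by (metis (no_types) bot_nat_0.not_eq_extremum mult.commute prime_power_canonical two_is_prime_nat)
  show ?thesis
  proof (intro exI[of _ m] conjI ballI m(2))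
    fix x assume x: "x \<in> fixed_sq"
    have "(x [^] m) [^] (2 ^ r :: nat) = \<one>"
      using pow_card_subgroup_eq_one[OF subgroup_fixed_sq x] x
      by (simp add: nat_pow_pow m(1) mult.commute)
    then have "x [^] m \<otimes> x [^] m = \<one>"
      by (rule pow[OF fixed_sq_pow[OF x]])
    then show "x [^] (2 * m) = \<one>" using x by (simp add: nat_pow_mult mult_2)
  qed
qed

end

text \<open>The noninjective case in abstract form. The counting hypotheses concern A only;
  information on B comes from lifting along \<phi>.\<close>

locale two_isogeny =
  A: frobenius_group A \<alpha> + B: frobenius_group B \<beta>
  for A (structure) and \<alpha> and B (structure) and \<beta> +
  fixes \<phi> T
  assumes hom: "\<phi> \<in> hom A B" and surj: "\<phi> ` carrier A = carrier B"
    and equivariant: "\<And>x. x \<in> carrier A \<Longrightarrow> \<phi> (\<alpha> x) = \<beta> (\<phi> x)"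
    and kernel: "{x \<in> carrier A. \<phi> x = \<one>\<^bsub>B\<^esub>} = {\<one>\<^bsub>A\<^esub>, T}" and T_neq_one: "T \<noteq> \<one>\<^bsub>A\<^esub>"
    and card_fixed: "card A.fixed mod 4 = 2" and card_antifixed: "card A.antifixed mod 4 = 2"
begin

sublocale \<phi>: group_hom A B \<phi>
  using hom by unfold_locales

lemma T: "T \<in> carrier A" "\<phi> T = \<one>\<^bsub>B\<^esub>"
  using kernel by blast+

lemma kernel_cases: "x \<in> carrier A \<Longrightarrow> \<phi> x = \<one>\<^bsub>B\<^esub> \<Longrightarrow> x = \<one>\<^bsub>A\<^esub> \<or> x = T"
  using kernel by blast

lemma T_torsion: "T \<otimes>\<^bsub>A\<^esub> T = \<one>\<^bsub>A\<^esub>"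
  using kernel_cases[of "T \<otimes>\<^bsub>A\<^esub> T"] T T_neq_one by auto

lemma T_fixed: "\<alpha> T = T"
proof -
  have "\<alpha> T \<noteq> \<one>\<^bsub>A\<^esub>" using T T_neq_one A.F_eq_iff[of T "\<one>\<^bsub>A\<^esub>"] by simp
  then show ?thesis using kernel_cases[of "\<alpha> T"] equivariant[of T] T by simp
qed

text \<open>A further fixed 2-torsion element would generate the whole 2-torsion group together with
  T. By Lagrange 4 would then divide the order of \<open>fixed\<close>.\<close>

lemma torsion_eq: "x \<in> A.torsion \<Longrightarrow> \<alpha> x = x \<Longrightarrow> x = \<one>\<^bsub>A\<^esub> \<or> x = T"
proof (rule ccontr)
  assume x: "x \<in> A.torsion" "\<alpha> x = x" "\<not> (x = \<one>\<^bsub>A\<^esub> \<or> x = T)"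
  obtain S where S: "S \<in> A.torsion" "A.torsion = {\<one>\<^bsub>A\<^esub>, T, S, S \<otimes>\<^bsub>A\<^esub> T}"
    using A.torsion_cases[of T] T T_torsion T_neq_one by auto
  have "\<alpha> S = S"
  proof (cases "x = S")
    case False
    then have "x = S \<otimes>\<^bsub>A\<^esub> T" using x S(2) by blast
    then have "\<alpha> S \<otimes>\<^bsub>A\<^esub> T = S \<otimes>\<^bsub>A\<^esub> T" using x(2) S(1) T T_fixed by simp
    then show ?thesis using S(1) T by (subst (asm) A.r_cancel) auto
  qed (use x in simp)
  then have sub: "A.torsion \<subseteq> A.fixed"
    unfolding S(2) using S(1) T T_fixed by auto
  interpret F: group "A\<lparr>carrier := A.fixed\<rparr>" using A.subgroup_fixed A.subgroup_imp_group by blast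
  have "subgroup A.torsion (A\<lparr>carrier := A.fixed\<rparr>)"
    using A.subgroup_incl[OF A.subgroup_torsion A.subgroup_fixed sub] .
  from F.lagrange[OF this, unfolded A.card_torsion Coset.order_def partial_object.simps]
  have "card (rcosets\<^bsub>A\<lparr>carrier := A.fixed\<rparr>\<^esub> A.torsion) * 4 = card A.fixed" by simp
  then have "4 dvd card A.fixed" by (intro dvdI) (simp flip: \<open>_ = card A.fixed\<close>)
  then show False using card_fixed by (simp add: dvd_eq_mod_eq_0)
qed

lemma double_eq_one_A:
  assumes "x \<in> A.fixed_sq" "(x \<otimes>\<^bsub>A\<^esub> x) \<otimes>\<^bsub>A\<^esub> (x \<otimes>\<^bsub>A\<^esub> x) = \<one>\<^bsub>A\<^esub>"
  shows "x \<otimes>\<^bsub>A\<^esub> x = \<one>\<^bsub>A\<^esub>"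
proof -
  have x: "x \<in> carrier A" "\<alpha> (\<alpha> x) = x" using assms(1) by auto
  define u v where "u = x \<otimes>\<^bsub>A\<^esub> \<alpha> x" and "v = x \<otimes>\<^bsub>A\<^esub> inv\<^bsub>A\<^esub> (\<alpha> x)"
  have uc: "u \<in> carrier A" "v \<in> carrier A" using x by (auto simp: u_def v_def)
  have au: "\<alpha> u = u" using x by (simp add: u_def A.m_comm)
  have av: "\<alpha> v = inv\<^bsub>A\<^esub> v" using x by (simp add: v_def A.inv_mult A.m_comm)
  have x4: "(\<alpha> x \<otimes>\<^bsub>A\<^esub> \<alpha> x) \<otimes>\<^bsub>A\<^esub> (\<alpha> x \<otimes>\<^bsub>A\<^esub> \<alpha> x) = \<one>\<^bsub>A\<^esub>"
    using arg_cong[OF assms(2), of \<alpha>] x by simp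
  have u4: "(u \<otimes>\<^bsub>A\<^esub> u) \<otimes>\<^bsub>A\<^esub> (u \<otimes>\<^bsub>A\<^esub> u) = \<one>\<^bsub>A\<^esub>"
  proof -
    have "(u \<otimes>\<^bsub>A\<^esub> u) \<otimes>\<^bsub>A\<^esub> (u \<otimes>\<^bsub>A\<^esub> u) = ((x \<otimes>\<^bsub>A\<^esub> x) \<otimes>\<^bsub>A\<^esub> (x \<otimes>\<^bsub>A\<^esub> x)) \<otimes>\<^bsub>A\<^esub>
        ((\<alpha> x \<otimes>\<^bsub>A\<^esub> \<alpha> x) \<otimes>\<^bsub>A\<^esub> (\<alpha> x \<otimes>\<^bsub>A\<^esub> \<alpha> x))"
      using x by (simp add: u_def A.m_ac)
    then show ?thesis using assms(2) x4 by simp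
  qed
  have uv: "u \<otimes>\<^bsub>A\<^esub> v = x \<otimes>\<^bsub>A\<^esub> x"
  proof -
    have "u \<otimes>\<^bsub>A\<^esub> v = (x \<otimes>\<^bsub>A\<^esub> x) \<otimes>\<^bsub>A\<^esub> (\<alpha> x \<otimes>\<^bsub>A\<^esub> inv\<^bsub>A\<^esub> (\<alpha> x))"
      using x by (simp add: u_def v_def A.m_ac del: A.r_inv A.l_inv)
    then show ?thesis using x by simp
  qed
  have u2: "u \<otimes>\<^bsub>A\<^esub> u = \<one>\<^bsub>A\<^esub>"
    using A.square_eq_one_if_card_mod_4[OF A.subgroup_fixed card_fixed _ u4] uc au by simp
  have vi: "(v \<otimes>\<^bsub>A\<^esub> v) \<otimes>\<^bsub>A\<^esub> (v \<otimes>\<^bsub>A\<^esub> v) = \<one>\<^bsub>A\<^esub>"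
  proof -
    have "((u \<otimes>\<^bsub>A\<^esub> v) \<otimes>\<^bsub>A\<^esub> (u \<otimes>\<^bsub>A\<^esub> v)) = (u \<otimes>\<^bsub>A\<^esub> u) \<otimes>\<^bsub>A\<^esub> (v \<otimes>\<^bsub>A\<^esub> v)"
      using uc by (simp add: A.m_ac)
    then have "v \<otimes>\<^bsub>A\<^esub> v = \<one>\<^bsub>A\<^esub>" using uv u2 assms(2) uc by simp
    then show ?thesis by simp
  qed
  have v2: "v \<otimes>\<^bsub>A\<^esub> v = \<one>\<^bsub>A\<^esub>"
    using A.square_eq_one_if_card_mod_4[OF A.subgroup_antifixed card_antifixed _ vi] uc av by simp
  \<comment> \<open>For an element of order at most 2 being negated is the same as being fixed, so
    \<open>torsion_eq\<close> applies to \<open>v\<close> as well.\<close>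
  have "\<alpha> v = v" using av v2 uc A.inv_equality by metis
  then have v: "v = \<one>\<^bsub>A\<^esub> \<or> v = T" using torsion_eq[of v] uc v2 by simp
  have u: "u = \<one>\<^bsub>A\<^esub> \<or> u = T" using torsion_eq[of u] uc u2 au by simp
  consider "u = \<one>\<^bsub>A\<^esub>" | "v = \<one>\<^bsub>A\<^esub>" | "u = T" "v = T" using u v by blast
  then show ?thesis
  proof cases
    case 1
    then have "\<alpha> x = inv\<^bsub>A\<^esub> x" using x unfolding u_def
      by (metis A.F_closed A.inv_equality A.m_comm)
    then show ?thesis
      using A.square_eq_one_if_card_mod_4[OF A.subgroup_antifixed card_antifixed _ assms(2)] x by simp
  next
    case 2
    then have "\<alpha> x = x" using x unfolding v_def
      by (metis A.F_closed A.inv_closed A.inv_equality A.inv_inv)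
    then show ?thesis
      using A.square_eq_one_if_card_mod_4[OF A.subgroup_fixed card_fixed _ assms(2)] x by simp
  next
    case 3
    then show ?thesis using uv T_torsion by simp
  qed
qed

text \<open>The injective map \<alpha> permutes the four 2-torsion elements and fixes the identity
  and T, but not S by \<open>torsion_eq\<close>; only one value remains.\<close>

lemma torsion_swap:
  assumes "S \<in> A.torsion" "S \<noteq> \<one>" "S \<noteq> T"
  shows "\<alpha> S = S \<otimes> T"
proof -
  obtain S' where S': "S' \<in> A.torsion" "A.torsion = {\<one>, T, S', S' \<otimes> T}"
    using A.torsion_cases[of T] T T_torsion T_neq_one by auto
  have c: "S \<in> carrier A" using assms by simp
  have ST: "S' \<otimes> T \<otimes> T = S'" using S'(1) T T_torsion by (simp add: A.m_assoc)
  have "\<alpha> S \<otimes> \<alpha> S = \<alpha> (S \<otimes> S)" using c by simp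
  then have t: "\<alpha> S \<in> A.torsion" using assms(1) by simp
  have "\<alpha> S \<noteq> \<alpha> \<one>" "\<alpha> S \<noteq> \<alpha> T" using assms c T by (simp_all del: A.F_one)
  then have "\<alpha> S \<noteq> \<one>" "\<alpha> S \<noteq> T" using T_fixed by simp_all
  moreover have "\<alpha> S \<noteq> S" using torsion_eq[of S] assms by blast
  moreover have "\<alpha> S \<in> {\<one>, T, S', S' \<otimes> T}" "S \<in> {\<one>, T, S', S' \<otimes> T}"
    using t assms(1) S'(2) by blast+
  ultimately show ?thesis using assms(2,3) ST by auto
qed

lemma torsion_fixed_sq_A: "A.torsion \<subseteq> A.fixed_sq"
proof
  fix S assume S: "S \<in> A.torsion"
  show "S \<in> A.fixed_sq"
  proof (cases "S = \<one> \<or> S = T")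
    case True
    then show ?thesis using S T_fixed by auto
  next
    case False
    then have "\<alpha> S = S \<otimes> T" using torsion_swap S by blast
    then show ?thesis using S T T_fixed T_torsion by (simp add: A.m_assoc)
  qed
qed

text \<open>As \<alpha> moves S by the kernel element T, the image of S is fixed by \<beta>. For
  curves it generates the kernel of the dual isogeny.\<close>

lemma torsion_image:
  assumes "S \<in> A.torsion" "S \<noteq> \<one>" "S \<noteq> T"
  shows "\<phi> S \<in> B.torsion" "\<phi> S \<noteq> \<one>\<^bsub>B\<^esub>" "\<beta> (\<phi> S) = \<phi> S"
proof -
  have S: "S \<in> carrier A" "S \<otimes> S = \<one>" using assms(1) by simp_all
  show "\<phi> S \<in> B.torsion" using S by (simp flip: \<phi>.hom_mult)
  show "\<phi> S \<noteq> \<one>\<^bsub>B\<^esub>" using kernel_cases assms S by blast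
  show "\<beta> (\<phi> S) = \<phi> S"
    using equivariant[OF S(1)] torsion_swap[OF assms] S T by simp
qed

text \<open>Since \<beta> fixes \<phi> S, it sends another 2-torsion element U to U or to its
  product with \<phi> S. In both cases applying \<beta> twice returns U.\<close>

lemma torsion_fixed_sq_B: "B.torsion \<subseteq> B.fixed_sq"
proof -
  obtain S where S: "S \<in> A.torsion" "S \<noteq> \<one>" "S \<noteq> T"
    using A.torsion_cases[of T] T T_torsion T_neq_one by auto
  note T' = torsion_image[OF S]
  obtain U where U: "U \<in> B.torsion" "U \<noteq> \<one>\<^bsub>B\<^esub>" "U \<noteq> \<phi> S" "U \<otimes>\<^bsub>B\<^esub> \<phi> S \<noteq> \<one>\<^bsub>B\<^esub>"
      "U \<otimes>\<^bsub>B\<^esub> \<phi> S \<noteq> \<phi> S" "U \<otimes>\<^bsub>B\<^esub> \<phi> S \<noteq> U" "B.torsion = {\<one>\<^bsub>B\<^esub>, \<phi> S, U, U \<otimes>\<^bsub>B\<^esub> \<phi> S}"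
    by (rule B.torsion_cases[OF T'(1,2)])
  have c: "U \<in> carrier B" "\<phi> S \<in> carrier B" using U(1) T'(1) by auto
  have "\<beta> U \<otimes>\<^bsub>B\<^esub> \<beta> U = \<beta> (U \<otimes>\<^bsub>B\<^esub> U)" using c by simp
  then have t: "\<beta> U \<in> B.torsion" using U(1) by simp
  have "\<beta> U \<noteq> \<beta> \<one>\<^bsub>B\<^esub>" "\<beta> U \<noteq> \<beta> (\<phi> S)" using U(2,3) c by (simp_all del: B.F_one T'(3))
  then have "\<beta> U \<noteq> \<one>\<^bsub>B\<^esub>" "\<beta> U \<noteq> \<phi> S" using T'(3) by simp_all
  moreover have "\<beta> U \<in> {\<one>\<^bsub>B\<^esub>, \<phi> S, U, U \<otimes>\<^bsub>B\<^esub> \<phi> S}" using t U(7) by blast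
  ultimately have "\<beta> U = U \<or> \<beta> U = U \<otimes>\<^bsub>B\<^esub> \<phi> S" by blast
  then have "\<beta> (\<beta> U) = U"
    using c T' by (auto simp: B.m_assoc)
  then show ?thesis
    unfolding U(7) using c T'(3) by auto
qed

text \<open>Both P and \<alpha> (\<alpha> P) lift Q, so they differ by an element of the kernel, and
  this defect disappears on squaring.\<close>

lemma lift_square:
  assumes "Q \<in> B.fixed_sq"
  obtains P where "P \<in> carrier A" "\<phi> P = Q" "P \<otimes> P \<in> A.fixed_sq"
    "\<alpha> (\<alpha> P) = P \<or> \<alpha> (\<alpha> P) = P \<otimes> T"
proof -
  have "Q \<in> \<phi> ` carrier A" using assms surj by simp
  then obtain P where P: "P \<in> carrier A" "\<phi> P = Q" by blast
  have "\<phi> (\<alpha> (\<alpha> P)) = Q" using P equivariant assms by simp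
  then have "\<phi> (inv P \<otimes> \<alpha> (\<alpha> P)) = \<one>\<^bsub>B\<^esub>" using P assms by simp
  then have "inv P \<otimes> \<alpha> (\<alpha> P) = \<one> \<or> inv P \<otimes> \<alpha> (\<alpha> P) = T" using P by (intro kernel_cases) auto
  then have "P \<otimes> (inv P \<otimes> \<alpha> (\<alpha> P)) = P \<or> P \<otimes> (inv P \<otimes> \<alpha> (\<alpha> P)) = P \<otimes> T" using P by auto
  moreover have "P \<otimes> (inv P \<otimes> \<alpha> (\<alpha> P)) = \<alpha> (\<alpha> P)" using P by (simp flip: A.m_assoc)
  ultimately have *: "\<alpha> (\<alpha> P) = P \<or> \<alpha> (\<alpha> P) = P \<otimes> T" by simp
  have "(P \<otimes> T) \<otimes> (P \<otimes> T) = (P \<otimes> P) \<otimes> (T \<otimes> T)" using P T by (simp add: A.m_ac)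
  then have "(P \<otimes> T) \<otimes> (P \<otimes> T) = P \<otimes> P" using T_torsion P by simp
  with * have "P \<otimes> P \<in> A.fixed_sq" using P by auto
  with that P * show ?thesis by blast
qed

text \<open>
  Let \<open>Q\<close> have order 4 and lift it to \<open>P\<close>. Then \<open>S = P \<otimes> P\<close> is a 2-torsion point outside
  the kernel, \<open>\<alpha>\<close> maps it to \<open>S \<otimes> T\<close>, and \<open>P \<otimes> \<alpha> P\<close> is a point of order 4 fixed
  by the square of \<open>\<alpha>\<close>.
\<close>

lemma double_eq_one_B:
  assumes Q: "Q \<in> B.fixed_sq" and Q4: "(Q \<otimes>\<^bsub>B\<^esub> Q) \<otimes>\<^bsub>B\<^esub> (Q \<otimes>\<^bsub>B\<^esub> Q) = \<one>\<^bsub>B\<^esub>"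
  shows "Q \<otimes>\<^bsub>B\<^esub> Q = \<one>\<^bsub>B\<^esub>"
proof -
  obtain P where P: "P \<in> carrier A" "\<phi> P = Q" "P \<otimes> P \<in> A.fixed_sq"
    "\<alpha> (\<alpha> P) = P \<or> \<alpha> (\<alpha> P) = P \<otimes> T" using lift_square[OF Q] by blast
  define S where "S = P \<otimes> P"
  have S: "S \<in> carrier A" "S \<in> A.fixed_sq" using P by (simp_all add: S_def)
  have Q2: "Q \<otimes>\<^bsub>B\<^esub> Q = \<phi> S" using P by (simp add: S_def)
  have "\<phi> (S \<otimes> S) = \<one>\<^bsub>B\<^esub>" using Q4 S unfolding Q2 by simp
  then have "S \<otimes> S = \<one> \<or> S \<otimes> S = T" using S by (intro kernel_cases) auto
  then have "(S \<otimes> S) \<otimes> (S \<otimes> S) = \<one>" using T_torsion by auto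
  then have SS: "S \<in> A.torsion" using double_eq_one_A[OF S(2)] S by simp
  have "\<phi> S = \<one>\<^bsub>B\<^esub>"
  proof (cases "S = \<one> \<or> S = T")
    case True
    then show ?thesis using T by auto
  next
    case False
    then have aS: "\<alpha> S = S \<otimes> T" using torsion_swap SS by blast
    have "\<alpha> (\<alpha> P) \<noteq> P"
    proof
      assume "\<alpha> (\<alpha> P) = P"
      then have "P \<in> A.fixed_sq" using P by simp
      moreover have "(P \<otimes> P) \<otimes> (P \<otimes> P) = \<one>" using SS by (simp add: S_def)
      ultimately have "P \<otimes> P = \<one>" by (rule double_eq_one_A)
      then show False using False S_def by simp
    qed
    then have aP: "\<alpha> (\<alpha> P) = P \<otimes> T" using P(4) by blast
    define R where "R = P \<otimes> \<alpha> P"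
    have R: "R \<in> carrier A" using P by (simp add: R_def)
    have "R \<otimes> R = S \<otimes> \<alpha> S" using P unfolding R_def S_def by (simp add: A.m_ac)
    also have "\<dots> = (S \<otimes> S) \<otimes> T" unfolding aS using S T by (simp add: A.m_assoc)
    finally have RR: "R \<otimes> R = T" using SS T by simp
    have "\<alpha> (\<alpha> R) = (P \<otimes> T) \<otimes> (\<alpha> P \<otimes> T)"
      using P T T_fixed aP unfolding R_def by simp
    also have "\<dots> = R \<otimes> (T \<otimes> T)" using P T unfolding R_def by (simp add: A.m_ac)
    finally have "R \<in> A.fixed_sq" using R T_torsion by simp
    moreover have "(R \<otimes> R) \<otimes> (R \<otimes> R) = \<one>" unfolding RR by (rule T_torsion)
    ultimately have "R \<otimes> R = \<one>" by (rule double_eq_one_A)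
    then show ?thesis using RR T_neq_one by simp
  qed
  then show ?thesis using Q2 by simp
qed

text \<open>Any bijection between Klein four groups that preserves the identity is an isomorphism,
  so the generators can be matched freely.\<close>

lemma torsion_iso:
  obtains \<psi> where "bij_betw \<psi> A.torsion B.torsion" "\<psi> \<one> = \<one>\<^bsub>B\<^esub>"
    "\<And>x y. x \<in> A.torsion \<Longrightarrow> y \<in> A.torsion \<Longrightarrow> \<psi> (x \<otimes> y) = \<psi> x \<otimes>\<^bsub>B\<^esub> \<psi> y"
proof -
  obtain S where S: "S \<in> A.torsion" "S \<noteq> \<one>" "S \<noteq> T" "S \<otimes> T \<noteq> \<one>" "S \<otimes> T \<noteq> T" "S \<otimes> T \<noteq> S"
      "A.torsion = {\<one>, T, S, S \<otimes> T}"
    using A.torsion_cases[of T] T T_torsion T_neq_one by auto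
  define V where "V = \<phi> S"
  have V: "V \<in> B.torsion" "V \<noteq> \<one>\<^bsub>B\<^esub>" using torsion_image[OF S(1-3)] by (simp_all add: V_def)
  obtain U where U: "U \<in> B.torsion" "U \<noteq> \<one>\<^bsub>B\<^esub>" "U \<noteq> V" "U \<otimes>\<^bsub>B\<^esub> V \<noteq> \<one>\<^bsub>B\<^esub>"
      "U \<otimes>\<^bsub>B\<^esub> V \<noteq> V" "U \<otimes>\<^bsub>B\<^esub> V \<noteq> U" "B.torsion = {\<one>\<^bsub>B\<^esub>, V, U, U \<otimes>\<^bsub>B\<^esub> V}"
    by (rule B.torsion_cases[OF V])
  define \<psi> where "\<psi> = (\<lambda>x. if x = \<one> then \<one>\<^bsub>B\<^esub> else if x = T then V else if x = S then U else U \<otimes>\<^bsub>B\<^esub> V)"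
  have \<psi>: "\<psi> \<one> = \<one>\<^bsub>B\<^esub>" "\<psi> T = V" "\<psi> S = U" "\<psi> (S \<otimes> T) = U \<otimes>\<^bsub>B\<^esub> V"
    using S T_neq_one by (auto simp: \<psi>_def)
  have "bij_betw \<psi> A.torsion B.torsion"
    unfolding bij_betw_def
  proof
    show "inj_on \<psi> A.torsion"
      unfolding S(7) using U V(2) by (auto simp: inj_on_def \<psi>)
    show "\<psi> ` A.torsion = B.torsion" unfolding S(7) U(7) by (auto simp: \<psi>)
  qed
  moreover have "\<psi> (x \<otimes> y) = \<psi> x \<otimes>\<^bsub>B\<^esub> \<psi> y" if "x \<in> A.torsion" "y \<in> A.torsion" for x y
  proof -
    have s: "S \<in> carrier A" "S \<otimes> S = \<one>" "T \<in> carrier A" "T \<otimes> T = \<one>" using S(1) T T_torsion by auto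
    have u: "U \<in> carrier B" "U \<otimes>\<^bsub>B\<^esub> U = \<one>\<^bsub>B\<^esub>" "V \<in> carrier B" "V \<otimes>\<^bsub>B\<^esub> V = \<one>\<^bsub>B\<^esub>"
      using U(1) V(1) by auto
    have 1: "T \<otimes> S = S \<otimes> T" "S \<otimes> (S \<otimes> T) = T" "T \<otimes> (S \<otimes> T) = S" "(S \<otimes> T) \<otimes> S = T" "(S \<otimes> T) \<otimes> T = S"
        "(S \<otimes> T) \<otimes> (S \<otimes> T) = \<one>"
    proof -
      show c: "T \<otimes> S = S \<otimes> T" using s by (simp add: A.m_comm)
      show d: "S \<otimes> (S \<otimes> T) = T" using s by (simp flip: A.m_assoc)
      show e: "(S \<otimes> T) \<otimes> T = S" using s by (simp add: A.m_assoc)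
      show "T \<otimes> (S \<otimes> T) = S" "(S \<otimes> T) \<otimes> S = T"
        using d e s by (simp_all add: A.m_comm)
      show "(S \<otimes> T) \<otimes> (S \<otimes> T) = \<one>" using d s by (metis A.m_assoc A.m_closed A.m_comm)
    qed
    have 2: "V \<otimes>\<^bsub>B\<^esub> U = U \<otimes>\<^bsub>B\<^esub> V" "U \<otimes>\<^bsub>B\<^esub> (U \<otimes>\<^bsub>B\<^esub> V) = V" "V \<otimes>\<^bsub>B\<^esub> (U \<otimes>\<^bsub>B\<^esub> V) = U"
        "(U \<otimes>\<^bsub>B\<^esub> V) \<otimes>\<^bsub>B\<^esub> U = V" "(U \<otimes>\<^bsub>B\<^esub> V) \<otimes>\<^bsub>B\<^esub> V = U" "(U \<otimes>\<^bsub>B\<^esub> V) \<otimes>\<^bsub>B\<^esub> (U \<otimes>\<^bsub>B\<^esub> V) = \<one>\<^bsub>B\<^esub>"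
    proof -
      show c: "V \<otimes>\<^bsub>B\<^esub> U = U \<otimes>\<^bsub>B\<^esub> V" using u by (simp add: B.m_comm)
      show d: "U \<otimes>\<^bsub>B\<^esub> (U \<otimes>\<^bsub>B\<^esub> V) = V" using u by (simp flip: B.m_assoc)
      show e: "(U \<otimes>\<^bsub>B\<^esub> V) \<otimes>\<^bsub>B\<^esub> V = U" using u by (simp add: B.m_assoc)
      show "V \<otimes>\<^bsub>B\<^esub> (U \<otimes>\<^bsub>B\<^esub> V) = U" "(U \<otimes>\<^bsub>B\<^esub> V) \<otimes>\<^bsub>B\<^esub> U = V"
        using d e u by (simp_all add: B.m_comm)
      show "(U \<otimes>\<^bsub>B\<^esub> V) \<otimes>\<^bsub>B\<^esub> (U \<otimes>\<^bsub>B\<^esub> V) = \<one>\<^bsub>B\<^esub>" using d u by (metis B.m_assoc B.m_closed B.m_comm)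
    qed
    have "x \<in> {\<one>, T, S, S \<otimes> T}" "y \<in> {\<one>, T, S, S \<otimes> T}" using that S(7) by blast+
    then show ?thesis by (elim insertE emptyE) (simp_all add: \<psi> s u 1 2)
  qed
  ultimately show ?thesis using that \<psi>(1) by blast
qed

text \<open>
  For odd \<open>m\<close> such that \<open>2 m\<close> annihilates both groups, the isomorphism is glued from \<open>\<phi>\<close> on the odd
  part and an isomorphism \<open>\<psi>\<close> of the 2-torsion groups.
\<close>

theorem fixed_sq_iso:
  "A\<lparr>carrier := A.fixed_sq\<rparr> \<cong> B\<lparr>carrier := B.fixed_sq\<rparr>"
proof -
  obtain \<psi> where \<psi>_bij: "bij_betw \<psi> A.torsion B.torsion" and \<psi>_one: "\<psi> \<one> = \<one>\<^bsub>B\<^esub>"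
    and \<psi>_mult: "\<And>x y. x \<in> A.torsion \<Longrightarrow> y \<in> A.torsion \<Longrightarrow> \<psi> (x \<otimes> y) = \<psi> x \<otimes>\<^bsub>B\<^esub> \<psi> y"
    using torsion_iso by blast
  have \<psi>_tors: "x \<in> A.torsion \<Longrightarrow> \<psi> x \<in> B.torsion" for x
    using \<psi>_bij bij_betwE by blast
  obtain mA :: nat where mA: "odd mA" "\<And>x. x \<in> A.fixed_sq \<Longrightarrow> x [^] (2 * mA) = \<one>"
    using A.pow_double_odd_eq_one[OF double_eq_one_A] by auto
  obtain mB :: nat where mB: "odd mB" "\<And>x. x \<in> B.fixed_sq \<Longrightarrow> x [^]\<^bsub>B\<^esub> (2 * mB) = \<one>\<^bsub>B\<^esub>"
    using B.pow_double_odd_eq_one[OF double_eq_one_B] by auto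
  define m where "m = mA * mB"
  have odd: "odd m" using mA mB by (simp add: m_def)
  have powA: "x [^] (2 * m * k) = \<one>" if "x \<in> A.fixed_sq" for x and k :: nat
  proof -
    have "x [^] (2 * m * k) = (x [^] (2 * mA)) [^] (mB * k)"
      using that by (simp add: A.nat_pow_pow m_def mult.assoc)
    then show ?thesis using mA(2)[OF that] by simp
  qed
  have powB: "x [^]\<^bsub>B\<^esub> (2 * m * k) = \<one>\<^bsub>B\<^esub>" if "x \<in> B.fixed_sq" for x and k :: nat
  proof -
    have "x [^]\<^bsub>B\<^esub> (2 * m * k) = (x [^]\<^bsub>B\<^esub> (2 * mB)) [^]\<^bsub>B\<^esub> (mA * k)"
      using that by (simp add: B.nat_pow_pow m_def mult_ac)
    then show ?thesis using mB(2)[OF that] by simp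
  qed
  have torsA: "x [^] m \<in> A.torsion" if "x \<in> A.fixed_sq" for x
    using powA[OF that, of 1] that by (simp add: A.nat_pow_mult mult_2)
  have torsB: "x [^]\<^bsub>B\<^esub> m \<in> B.torsion" if "x \<in> B.fixed_sq" for x
    using powB[OF that, of 1] that by (simp add: B.nat_pow_mult mult_2)
  have "even (m + 1)" using odd by simp
  then obtain j where j: "m + 1 = 2 * j" by blast
  have evenA: "x [^] (m + 1) = \<one>" if "x \<in> A.torsion" for x
  proof -
    have "x [^] (m + 1) = (x [^] (2 :: nat)) [^] j" unfolding j using that by (simp add: A.nat_pow_pow)
    also have "x [^] (2 :: nat) = \<one>" using that by (simp add: numeral_eq_Suc)
    finally show ?thesis by simp
  qed
  have oddA: "x [^] m = x" if "x \<in> A.torsion" for x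
  proof -
    have "x [^] m \<otimes> x = x \<otimes> x" using evenA[OF that] that by simp
    then show ?thesis using that by (metis (mono_tags, lifting) A.nat_pow_closed A.r_cancel mem_Collect_eq)
  qed
  \<comment> \<open>Modulo 2 m the exponents m + 1 and m are the complementary idempotents: the
    first projects to the odd part, the second to the 2-torsion.\<close>
  define h where "h = (\<lambda>x. \<phi> (x [^] (m + 1)) \<otimes>\<^bsub>B\<^esub> \<psi> (x [^] m))"
  have fixB: "\<phi> x \<in> B.fixed_sq" if "x \<in> A.fixed_sq" for x
    using that by (simp flip: equivariant)
  have h_closed: "h x \<in> B.fixed_sq" if "x \<in> A.fixed_sq" for x
    unfolding h_def using fixB[OF A.fixed_sq_pow[OF that, of "m + 1"]]
      \<psi>_tors[OF torsA[OF that]] torsion_fixed_sq_B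
    by (intro subgroup.m_closed[OF B.subgroup_fixed_sq]) blast+
  have h_mult: "h (x \<otimes> y) = h x \<otimes>\<^bsub>B\<^esub> h y" if "x \<in> A.fixed_sq" "y \<in> A.fixed_sq" for x y
  proof -
    have c: "x \<in> carrier A" "y \<in> carrier A" using that by auto
    have "\<psi> (x [^] m) \<in> carrier B" "\<psi> (y [^] m) \<in> carrier B"
      using \<psi>_tors[OF torsA] that by auto
    then show ?thesis
      unfolding h_def A.nat_pow_distrib[OF c] \<psi>_mult[OF torsA torsA, OF that]
      using c by (simp add: B.m_ac del: A.nat_pow_Suc)
  qed
  have h_tors: "h x = \<psi> x" if "x \<in> A.torsion" for x
    using evenA[OF that] oddA[OF that] \<psi>_tors[OF that] by (simp add: h_def)
  have inj: "x = \<one>" if x: "x \<in> A.fixed_sq" "h x = \<one>\<^bsub>B\<^esub>" for x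
  proof -
    have c: "x \<in> carrier A" using x by simp
    \<comment> \<open>Since \<open>v\<close> has order at most 2 and \<open>u\<close> is its
      inverse, \<phi> kills the square of \<open>x [^] (m + 1)\<close>, which is the square of x.
      This puts x into the 2-torsion, where \<open>h\<close> is the injective \<psi>.\<close>
    define u v where "u = \<phi> (x [^] (m + 1))" and "v = \<psi> (x [^] m)"
    have v: "v \<in> carrier B" "v \<otimes>\<^bsub>B\<^esub> v = \<one>\<^bsub>B\<^esub>" using \<psi>_tors[OF torsA[OF x(1)]] by (auto simp: v_def)
    have u: "u \<in> carrier B" using c by (simp add: u_def)
    have "u \<otimes>\<^bsub>B\<^esub> v = \<one>\<^bsub>B\<^esub>" using x(2) by (simp add: h_def u_def v_def)
    then have "u = v" using B.inv_equality[of u v] B.inv_equality[of v v] u v by simp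
    then have "u \<otimes>\<^bsub>B\<^esub> u = \<one>\<^bsub>B\<^esub>" using v by simp
    then have "\<phi> (x [^] (m + 1) \<otimes> x [^] (m + 1)) = \<one>\<^bsub>B\<^esub>" using c by (simp add: u_def)
    moreover have "x [^] (m + 1) \<otimes> x [^] (m + 1) = x \<otimes> x"
    proof -
      have "x [^] (m + 1) \<otimes> x [^] (m + 1) = x [^] ((m + 1) + (m + 1))"
        using c by (rule A.nat_pow_mult)
      also have "(m + 1) + (m + 1) = 2 * m * 1 + 2" by simp
      also have "x [^] (2 * m * 1 + 2) = x [^] (2 * m * 1) \<otimes> x [^] (2 :: nat)"
        using c by (rule A.nat_pow_mult[symmetric])
      also have "\<dots> = x [^] (2 :: nat)" unfolding powA[OF x(1)] using c by simp
      finally show ?thesis using c by (simp add: numeral_eq_Suc)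
    qed
    ultimately have "\<phi> (x \<otimes> x) = \<one>\<^bsub>B\<^esub>" by (simp only:)
    then have "x \<otimes> x = \<one> \<or> x \<otimes> x = T" using c by (intro kernel_cases) auto
    then have "(x \<otimes> x) \<otimes> (x \<otimes> x) = \<one>" using T_torsion by auto
    then have "x \<in> A.torsion" using double_eq_one_A[OF x(1)] c by simp
    then have "\<psi> x = \<psi> \<one>" "x \<in> A.torsion" "\<one> \<in> A.torsion" using h_tors x(2) \<psi>_one by auto
    then show ?thesis using \<psi>_bij by (auto simp: bij_betw_def dest: inj_onD)
  qed
  have surj': "\<exists>x \<in> A.fixed_sq. h x = Q" if Q: "Q \<in> B.fixed_sq" for Q
  proof -
    obtain P where P: "P \<in> carrier A" "\<phi> P = Q" "P \<otimes> P \<in> A.fixed_sq" using lift_square[OF Q] by blast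
    have Qc: "Q \<in> carrier B" using Q by simp
    obtain s where s: "s \<in> A.torsion" "\<psi> s = Q [^]\<^bsub>B\<^esub> m"
      using torsB[OF Q] \<psi>_bij by (metis (no_types, lifting) bij_betw_def imageE)
    \<comment> \<open>The lift P need not lie in \<open>fixed_sq\<close>, but its square does. As m
      + 1 = 2 j, the element x is P to the power (m + 1)^2, a lift of the odd part of Q.\<close>
    define x where "x = (P \<otimes> P) [^] (2 * j * j)"
    have xP: "x = P [^] (4 * j * j)"
    proof -
      have "P \<otimes> P = P [^] (2 :: nat)" using P by (simp add: numeral_eq_Suc)
      then show ?thesis using P(1) by (simp add: x_def A.nat_pow_pow mult.assoc)
    qed
    have x: "x \<in> A.fixed_sq" unfolding x_def by (rule A.fixed_sq_pow[OF P(3)])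
    have "x [^] m = (P \<otimes> P) [^] (2 * m * (j * j))"
      using P unfolding x_def by (simp add: A.nat_pow_pow mult_ac)
    then have xm: "x [^] m = \<one>" unfolding powA[OF P(3)] .
    \<comment> \<open>The left side is (m + 1)^3; the identity exhibits its congruence to m + 1
      modulo 2 m.\<close>
    have e: "4 * j * j * (m + 1) = 2 * m * (2 * j * j + j) + (m + 1)"
    proof -
      have "4 * j * j * (m + 1) = 2 * m * (2 * j * j) + 2 * j * (2 * j)"
        by (simp add: algebra_simps)
      also have "2 * j * (2 * j) = m * (2 * j) + (m + 1)" unfolding j[symmetric] by simp
      finally show ?thesis
        by (simp only: distrib_left mult.left_commute mult.commute mult.assoc add.assoc)
    qed
    have "\<phi> (x [^] (m + 1)) = Q [^]\<^bsub>B\<^esub> (4 * j * j * (m + 1))"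
      unfolding xP A.nat_pow_pow[OF P(1)] using P by (simp add: \<phi>.hom_nat_pow)
    also have "\<dots> = Q [^]\<^bsub>B\<^esub> (2 * m * (2 * j * j + j)) \<otimes>\<^bsub>B\<^esub> Q [^]\<^bsub>B\<^esub> (m + 1)"
      unfolding e by (rule B.nat_pow_mult[OF Qc, symmetric])
    also have "\<dots> = Q [^]\<^bsub>B\<^esub> (m + 1)" unfolding powB[OF Q] using Qc by simp
    finally have "h x = Q [^]\<^bsub>B\<^esub> (m + 1)" unfolding h_def xm \<psi>_one using Qc by simp
    moreover have "h s = Q [^]\<^bsub>B\<^esub> m" using h_tors s by simp
    moreover have s': "s \<in> A.fixed_sq" using s torsion_fixed_sq_A by blast
    ultimately have "h (x \<otimes> s) = Q [^]\<^bsub>B\<^esub> (m + 1) \<otimes>\<^bsub>B\<^esub> Q [^]\<^bsub>B\<^esub> m"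
      using h_mult[OF x s'] by simp
    also have "\<dots> = Q [^]\<^bsub>B\<^esub> (2 * m * 1 + 1)" unfolding B.nat_pow_mult[OF Qc] by (simp add: mult_2)
    also have "\<dots> = Q [^]\<^bsub>B\<^esub> (2 * m * 1) \<otimes>\<^bsub>B\<^esub> Q [^]\<^bsub>B\<^esub> (1 :: nat)" by (rule B.nat_pow_mult[OF Qc, symmetric])
    also have "\<dots> = Q" unfolding powB[OF Q] using Qc by simp
    finally show ?thesis using subgroup.m_closed[OF A.subgroup_fixed_sq x s'] by blast
  qed
  have "h \<in> hom (A\<lparr>carrier := A.fixed_sq\<rparr>) (B\<lparr>carrier := B.fixed_sq\<rparr>)"
    using h_closed h_mult by (intro homI) simp_all
  moreover have "bij_betw h A.fixed_sq B.fixed_sq"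
    unfolding bij_betw_def
  proof
    show "inj_on h A.fixed_sq"
    proof (rule inj_onI)
      fix x y assume x: "x \<in> A.fixed_sq" and y: "y \<in> A.fixed_sq" and e: "h x = h y"
      have y': "inv y \<in> A.fixed_sq" by (rule subgroup.m_inv_closed[OF A.subgroup_fixed_sq y])
      have "h (x \<otimes> inv y) = h y \<otimes>\<^bsub>B\<^esub> h (inv y)" using h_mult[OF x y'] e by simp
      also have "\<dots> = h \<one>" using h_mult[OF y y'] y by simp
      also have "\<dots> = \<one>\<^bsub>B\<^esub>" using h_tors[of \<one>] \<psi>_one by simp
      finally have "x \<otimes> inv y = \<one>"
        by (rule inj[OF subgroup.m_closed[OF A.subgroup_fixed_sq x y']])
      then show "x = y" using x y A.inv_equality[of x "inv y"] by simp
    qed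
    show "h ` A.fixed_sq = B.fixed_sq" using h_closed surj' by blast
  qed
  ultimately show ?thesis unfolding is_iso_def iso_def by auto
qed

end

section \<open>The isomorphism\<close>

lemma (in curve_over_prime_field) frobenius_group_point_group: "frobenius_group (point_group UNIV E) frob"
proof -
  interpret G: comm_group "point_group UNIV E" by (rule comm_group_point_group[OF nonsingular])
  show ?thesis
  proof
    show "frob \<in> hom (point_group UNIV E) (point_group UNIV E)"
      by (rule homI) (simp_all add: point_group_simps on_curve_frob frob_add)
    show "inj_on frob (carrier (point_group UNIV E))" by (auto simp: inj_on_def frob_inject)
    show "card {P \<in> carrier (point_group UNIV E). P \<otimes>\<^bsub>point_group UNIV E\<^esub> P = \<one>\<^bsub>point_group UNIV E\<^esub>} = 4"
      using card_double_eq_Infinity[OF nonsingular two_neq_zero] by (simp add: point_group_simps)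
    have "p\<^sup>2 > 1" using p_gt_1 by (rule one_less_power) simp
    from finite_points_GF[OF this]
    show "finite {P \<in> carrier (point_group UNIV E). frob (frob P) = P}"
      unfolding points_GF_p2 by (simp add: point_group_simps)
  qed
qed

theorem theorem3p3:
  fixes p :: nat
    and E E' :: "'k::alg_closed_field weierstrass"
    and \<phi> :: "'k point \<Rightarrow> 'k point"
  assumes "Factorial_Ring.prime p" and "odd p" and "CHAR('k) = p"
    and "elliptic_curve_over (GF p) E" and "elliptic_curve_over (GF p) E'"
    and "ordinary E" and "ordinary E'"
    and "isogeny_over (GF p) E E' \<phi>" and "has_degree (GF p) E E' \<phi> 2"
    and "[card (points (GF p) E) = 2] (mod 4)"
  shows "point_group (GF (p\<^sup>2)) E \<cong> point_group (GF (p\<^sup>2)) E'"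
proof -
  interpret C: curve_over_prime_field p E using assms by unfold_locales
  interpret C': curve_over_prime_field p E' using assms by unfold_locales
  interpret A: frobenius_group "point_group UNIV E" C.frob by (rule C.frobenius_group_point_group)
  \<comment> \<open>The map \<open>frob\<close> depends on p alone, so both curves share it.\<close>
  interpret B: frobenius_group "point_group UNIV E'" C.frob by (rule C'.frobenius_group_point_group)
  have morph: "morphism_over (GF p) E E' \<phi>" and surj: "\<phi> ` points UNIV E = points UNIV E'"
    and hom: "\<phi> \<in> hom (point_group UNIV E) (point_group UNIV E')"
    using assms(8) unfolding isogeny_over_def by auto
  interpret \<phi>: group_hom "point_group UNIV E" "point_group UNIV E'" \<phi>
    using hom by unfold_locales
  have surj': "\<phi> ` carrier (point_group UNIV E) = carrier (point_group UNIV E')"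
    using surj by (simp add: point_group_def)
  have equiv: "\<phi> (C.frob P) = C.frob (\<phi> P)" if "P \<in> carrier (point_group UNIV E)" for P
    using C.morphism_frob[OF morph] that by (simp add: point_group_simps)
  have GF01: "0 \<in> (GF p :: 'k set)" "1 \<in> (GF p :: 'k set)" using C.p_pos by (simp_all add: GF_def)
  define K where "K = {P \<in> carrier (point_group UNIV E). \<phi> P = \<one>\<^bsub>point_group UNIV E'\<^esub>}"
  have one: "\<one>\<^bsub>point_group UNIV E\<^esub> \<in> K" by (simp add: K_def)
  have three: "S1 = S2 \<or> S1 = S3 \<or> S2 = S3" if "S1 \<in> K" "S2 \<in> K" "S3 \<in> K" for S1 S2 S3
    using no_three_kernel_points[OF C.nonsingular C.two_neq_zero assms(9) GF01 hom, of S1 S2 S3] that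
    by (simp add: K_def point_group_simps)
  show ?thesis
  proof (cases "K = {\<one>\<^bsub>point_group UNIV E\<^esub>}")
    case True
    have inj: "inj_on \<phi> (carrier (point_group UNIV E))"
      using True by (intro \<phi>.trivial_ker_imp_inj) (simp add: K_def kernel_def)
    have "bij_betw \<phi> A.fixed_sq B.fixed_sq"
      unfolding bij_betw_def
    proof
      show "inj_on \<phi> A.fixed_sq" using inj by (rule inj_on_subset) blast
      show "\<phi> ` A.fixed_sq = B.fixed_sq"
      proof (intro equalityI subsetI)
        fix Q assume "Q \<in> \<phi> ` A.fixed_sq"
        then show "Q \<in> B.fixed_sq" by (auto simp flip: equiv)
      next
        fix Q assume Q: "Q \<in> B.fixed_sq"
        then have "Q \<in> \<phi> ` carrier (point_group UNIV E)" unfolding surj' by simp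
        then obtain P where P: "P \<in> carrier (point_group UNIV E)" "\<phi> P = Q" by auto
        then have "\<phi> (C.frob (C.frob P)) = \<phi> P" using Q by (simp add: equiv)
        then have "C.frob (C.frob P) = P" using inj_onD[OF inj, of "C.frob (C.frob P)" P] P by simp
        then show "Q \<in> \<phi> ` A.fixed_sq" using P by blast
      qed
    qed
    then have "\<phi> \<in> iso (point_group (GF (p\<^sup>2)) E) (point_group (GF (p\<^sup>2)) E')"
      unfolding C.point_group_GF_p2 C'.point_group_GF_p2
      by (auto simp: iso_def bij_betw_def intro!: homI)
    then show ?thesis by (auto simp: is_iso_def)
  next
    case False
    then obtain T where T: "T \<in> K" "T \<noteq> \<one>\<^bsub>point_group UNIV E\<^esub>" using one by blast
    have "K = {\<one>\<^bsub>point_group UNIV E\<^esub>, T}" using one T three by blast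
    moreover have N: "card A.fixed mod 4 = 2"
      using assms(10) unfolding C.points_GF_p by (simp add: cong_def point_group_simps)
    moreover have "card A.antifixed mod 4 = 2"
    proof -
      have "A.antifixed = {P \<in> points UNIV E. C.frob P = point_neg E P}"
        using inv_point_group[OF C.nonsingular] by (auto simp: point_group_simps)
      moreover have "A.fixed = {P \<in> points UNIV E. C.frob P = P}" by (simp add: point_group_simps)
      ultimately have "card A.fixed + card A.antifixed = 2 * (p + 1)"
        using C.card_fixed_plus_card_antifixed by simp
      moreover have "b mod 4 = 2" if ab: "a + b = 2 * (p + 1)" "a mod 4 = 2" for a b
      proof -
        obtain k where "p = 2 * k + 1" using assms(2) by (rule oddE)
        then have "a + b = 4 * (k + 1)" using ab(1) by simp
        \<comment> \<open>As p is odd, 2 (p + 1) is divisible by 4, so two counts with this sum are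
          2 modulo 4 together.\<close>
        then have "(a mod 4 + b mod 4) mod 4 = 0" unfolding mod_add_eq by simp
        moreover have "b mod 4 < 4" by simp
        then have "b mod 4 = 0 \<or> b mod 4 = 1 \<or> b mod 4 = 2 \<or> b mod 4 = 3" by linarith
        ultimately show ?thesis unfolding ab(2) by (elim disjE) simp_all
      qed
      ultimately show ?thesis using N by (simp only:)
    qed
    ultimately interpret two_isogeny "point_group UNIV E" C.frob "point_group UNIV E'" C.frob \<phi> T
      using hom surj' equiv T(2) by unfold_locales (simp_all add: K_def)
    show ?thesis
      unfolding C.point_group_GF_p2 C'.point_group_GF_p2 by (rule fixed_sq_iso)
  qed
qed

end
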